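(* Let $Q(x)=\prod_{j=1}^\infty (1-x^j)^{-j}=1+\sum_{n\ge 1} q(n)x^n$, so that $q(n)$ is the number of plane partitions of $n$. Let $\{d_n\}_{n\ge1}$ be a sequence satisfying $$d_n=\left(\frac{2\zeta(3)}{n}\right)^{1/3}-\frac{1}{36n}+O(n^{-1-\beta}),\qquad n\to\infty,$$ for some fixed constant $\beta>0$, and put $r_n=e^{-d_n}$ and $\delta_n=d_n^{5/3}/\log n$. Let $F(x)$ be a function analytic in the unit disk $|x|<1$ satisfying: (A) $\displaystyle\lim_{n\to\infty}\frac{F(r_n e^{i\theta})}{F(r_n)}=1$ uniformly for $|\theta|\le \delta_n$; (B) there exist constants $C>0$ and $\eta\in(0,2/3)$ such that $F(x)=O\big(e^{C/(1-|x|)^{\eta}}\big)$ as $|x|\to 1$. Then there is a constant $c>0$ such that, as $n\to\infty$, $$\frac{1}{q(n)}[x^n]\,Q(x)F(x)=F(e^{-d_n})(1+o(1))+O\big(e^{-c n^{2/9}/\log^2 n}\big).$$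
   Context: $\zeta$ denotes the Riemann zeta function, and $[x^n]G(x)$ denotes the coefficient of $x^n$ in the power series $G(x)$. A plane partition of $n$ is an array $(\omega_{h,j})_{h,j\ge1}$ of non-negative integers with $\sum_{h,j}\omega_{h,j}=n$ and $\omega_{h,j}\ge\omega_{h+1,j}$, $\omega_{h,j}\ge\omega_{h,j+1}$ for all $h,j$. *)

theory Defs
  imports "HOL-Complex_Analysis.Complex_Analysis" "HOL-Library.Landau_Symbols"
begin

text \<open>The Dirichlet series of the Riemann zeta function; it represents \<open>\<zeta>(s)\<close> for \<open>s > 1\<close> only,
  which covers the value \<open>\<zeta>(3)\<close> used here.\<close>
definition zeta :: "real \<Rightarrow> real" where
  "zeta s = (\<Sum>n. 1 / real (Suc n) powr s)"

text \<open>\<open>[x\<^sup>n] G(x)\<close> for a function \<open>G\<close> holomorphic near \<open>0\<close>.\<close>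
definition ps_coeff :: "nat \<Rightarrow> (complex \<Rightarrow> complex) \<Rightarrow> complex" where
  "ps_coeff n G = fps_nth (fps_expansion G 0) n"

text \<open>The infinite product converges for \<open>|x| < 1\<close>; the values elsewhere are irrelevant.
  The index is shifted, since \<open>prodinf\<close> starts at \<open>0\<close>.\<close>
definition Q :: "complex \<Rightarrow> complex" where
  "Q x = (\<Prod>j. inverse ((1 - x ^ Suc j) ^ Suc j))"

definition q :: "nat \<Rightarrow> complex" where
  "q n = ps_coeff n Q"

end

theory Submission
  imports Defs "HOL-Probability.Probability" "HOL-Real_Asymp.Real_Asymp"
begin

text \<open>The coefficients are Cauchy integrals over the circle of radius \<open>e\<^sup>-\<^sup>d\<close> with \<open>d = d\<^sub>n\<close>, in the
  scaled angle \<open>\<theta> = d\<^sup>2 u\<close>. Since \<open>log Q(x) = \<Sum>\<^sub>k x\<^sup>k / (k (1 - x\<^sup>k)\<^sup>2)\<close>, comparing only the first summand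
  with its value on the positive axis gives
  \<open>|Q(e\<^sup>-\<^sup>d\<^sup>+\<^sup>i\<^sup>\<theta>)| \<le> Q(e\<^sup>-\<^sup>d) exp(- \<theta>\<^sup>2 / (72 d\<^sup>2 (d\<^sup>2 + \<theta>\<^sup>2)))\<close> on the whole circle. This bound
  dominates the scaled integrand and makes the part \<open>|\<theta>| > \<delta>\<^sub>n\<close> as small as
  \<open>exp(- c n\<^bsup>2/9\<^esup> / log\<^sup>2 n)\<close>, which beats the growth of \<open>F\<close> because \<open>\<eta>/3 < 2/9\<close>. A Taylor expansion
  of \<open>log Q\<close> in \<open>\<theta>\<close> shows that \<open>Q(e\<^sup>-\<^sup>d\<^sup>+\<^sup>i\<^sup>\<theta>) e\<^sup>-\<^sup>i\<^sup>n\<^sup>\<theta> / Q(e\<^sup>-\<^sup>d)\<close> tends to \<open>exp(- 3 \<zeta>(3) u\<^sup>2)\<close>, because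
  \<open>2 \<zeta>(3) / d - n d\<^sup>2 \<rightarrow> 0\<close>. By dominated convergence \<open>q(n)\<close> is then of the exact order
  \<open>e\<^sup>n\<^sup>d Q(e\<^sup>-\<^sup>d) d\<^sup>2\<close>, which bounds the contribution of \<open>F - F(e\<^sup>-\<^sup>d)\<close> on \<open>|\<theta>| \<le> \<delta>\<^sub>n\<close>.\<close>

subsection \<open>Power moments of the geometric series\<close>

definition moment :: "nat \<Rightarrow> 'a :: {real_normed_field, banach} \<Rightarrow> 'a" where
  "moment m y = (\<Sum>j. of_nat j ^ m * y ^ j)"

lemma summable_moment:
  fixes y :: "'a :: {real_normed_field, banach}"
  assumes "norm y < 1"
  shows "summable (\<lambda>j. of_nat j ^ m * y ^ j)"
  using assms
proof (induction m arbitrary: y)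
  case 0
  then show ?case by (simp add: summable_geometric)
next
  case (Suc m)
  then have "summable (\<lambda>j. y * (diffs (\<lambda>j. of_nat j ^ m) j * y ^ j))"
    by (intro summable_mult termdiff_converges)
  then have "summable (\<lambda>j. of_nat (Suc j) ^ Suc m * y ^ Suc j)"
    by (simp add: diffs_def mult_ac)
  then show ?case by (subst (asm) summable_Suc_iff)
qed

lemma moment_sums:
  "norm y < 1 \<Longrightarrow> (\<lambda>j. of_nat j ^ m * y ^ j) sums moment m y"
  unfolding moment_def by (rule summable_sums[OF summable_moment])

lemma moment_norm_sums:
  fixes y :: "'a :: {real_normed_field, banach}"
  assumes "norm y < 1"
  shows "(\<lambda>j. norm (of_nat j ^ m * y ^ j)) sums moment m (norm y)"
  using moment_sums[of "norm y" m] assms by (simp add: norm_mult norm_power)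

lemma norm_moment_le:
  assumes "norm y \<le> \<rho>" "\<rho> < 1"
  shows "norm (moment m y) \<le> moment m \<rho>"
proof (rule norm_sums_le[OF moment_sums moment_sums])
  show "norm (of_nat j ^ m * y ^ j) \<le> of_nat j ^ m * \<rho> ^ j" for j
    using assms by (auto simp: norm_mult norm_power intro!: mult_left_mono power_mono)
  show "norm y < 1" "norm \<rho> < 1"
    using assms order_trans[OF norm_ge_zero assms(1)] by auto
qed

lemma of_real_moment:
  assumes "\<bar>\<rho>\<bar> < 1"
  shows "moment m (of_real \<rho>) = of_real (moment m \<rho>)"
  using sums_of_real[OF moment_sums[of \<rho> m]] assms
  by (intro sums_unique2[OF moment_sums]) simp_all

lemma moment_Suc_eq:
  fixes f :: "'a :: {real_normed_field, banach} \<Rightarrow> 'a"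
  assumes "\<And>z. norm z < 1 \<Longrightarrow> moment m z = f z"
    and "(f has_field_derivative f') (at y)" and "norm y < 1"
  shows "moment (Suc m) y = y * f'"
proof -
  have "(\<lambda>j. of_nat j ^ m * z ^ j) sums f z" if "norm z < 1" for z
    using moment_sums[OF that, of m] assms(1)[OF that] by simp
  then have "(\<lambda>j. diffs (\<lambda>j. of_nat j ^ m) j * y ^ j) sums f'"
    by (rule termdiffs_sums_strong[OF _ assms(2,3)])
  from sums_mult[OF this, of y]
  have "(\<lambda>j. of_nat (Suc j) ^ Suc m * y ^ Suc j) sums (y * f')"
    by (simp add: diffs_def mult_ac)
  then have "(\<lambda>j. of_nat j ^ Suc m * y ^ j) sums (y * f')"
    by (subst (asm) sums_Suc_iff) simp
  with moment_sums[OF assms(3)] show ?thesis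
    by (rule sums_unique2)
qed

lemma moment_0: "norm y < 1 \<Longrightarrow> moment 0 y = 1 / (1 - y)"
  by (simp add: moment_def suminf_geometric)

lemma moment_1:
  assumes "norm y < 1"
  shows "moment 1 y = y / (1 - y)\<^sup>2"
proof -
  have "((\<lambda>y. 1 / (1 - y)) has_field_derivative (1 / (1 - y)\<^sup>2)) (at y)"
    using assms by (auto intro!: derivative_eq_intros simp: power2_eq_square)
  from moment_Suc_eq[OF moment_0 this assms] show ?thesis by simp
qed

lemma moment_2:
  assumes "norm y < 1"
  shows "moment 2 y = y * (1 + y) / (1 - y) ^ 3"
proof -
  have "((\<lambda>y. y / (1 - y)\<^sup>2) has_field_derivative ((1 + y) / (1 - y) ^ 3)) (at y)"
    using assms by (auto intro!: derivative_eq_intros simp: divide_simps) algebra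
  from moment_Suc_eq[OF moment_1 this assms] show ?thesis by (simp add: numeral_2_eq_2)
qed

lemma moment_3:
  assumes "norm y < 1"
  shows "moment 3 y = y * (1 + 4 * y + y\<^sup>2) / (1 - y) ^ 4"
proof -
  have "((\<lambda>y. y * (1 + y) / (1 - y) ^ 3) has_field_derivative
          ((1 + 4 * y + y\<^sup>2) / (1 - y) ^ 4)) (at y)"
    using assms by (auto intro!: derivative_eq_intros simp: divide_simps) algebra
  from moment_Suc_eq[OF moment_2 this assms] show ?thesis by (simp add: numeral_3_eq_3 numeral_2_eq_2)
qed

lemma moment_4:
  assumes "norm y < 1"
  shows "moment 4 y = y * (1 + 11 * y + 11 * y\<^sup>2 + y ^ 3) / (1 - y) ^ 5"
proof -
  have "((\<lambda>y. y * (1 + 4 * y + y\<^sup>2) / (1 - y) ^ 4) has_field_derivative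
          ((1 + 11 * y + 11 * y\<^sup>2 + y ^ 3) / (1 - y) ^ 5)) (at y)"
    using assms by (auto intro!: derivative_eq_intros simp: divide_simps) algebra
  from moment_Suc_eq[OF moment_3 this assms] show ?thesis by (simp add: eval_nat_numeral)
qed

lemma bounded_on_pos_real:
  fixes f :: "real \<Rightarrow> real"
  assumes cont: "continuous_on {0<..} f"
    and lim0: "(f \<longlongrightarrow> a) (at_right 0)" and lim1: "(f \<longlongrightarrow> b) at_top"
  obtains C where "\<And>x. 0 < x \<Longrightarrow> \<bar>f x\<bar> \<le> C"
proof -
  have "eventually (\<lambda>x. \<bar>f x\<bar> < \<bar>a\<bar> + 1) (at_right 0)"
    by (rule order_tendstoD(2)[OF tendsto_rabs[OF lim0]]) simp
  then obtain \<epsilon> where near_0: "\<epsilon> > 0" "\<And>x. 0 < x \<Longrightarrow> x < \<epsilon> \<Longrightarrow> \<bar>f x\<bar> < \<bar>a\<bar> + 1"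
    by (auto simp: eventually_at_right_field)
  have "eventually (\<lambda>x. \<bar>f x\<bar> < \<bar>b\<bar> + 1) at_top"
    by (rule order_tendstoD(2)[OF tendsto_rabs[OF lim1]]) simp
  then obtain N where near_infinity: "\<And>x. x \<ge> N \<Longrightarrow> \<bar>f x\<bar> < \<bar>b\<bar> + 1"
    by (auto simp: eventually_at_top_linorder)
  have "compact (f ` {\<epsilon>..N})"
    using near_0 by (intro compact_continuous_image continuous_on_subset[OF cont]) auto
  then obtain B where middle_bound: "\<And>x. x \<in> {\<epsilon>..N} \<Longrightarrow> \<bar>f x\<bar> \<le> B"
    using compact_imp_bounded bounded_iff by (metis imageI real_norm_def)
  show ?thesis
  proof (rule that[of "\<bar>a\<bar> + \<bar>b\<bar> + \<bar>B\<bar> + 1"])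
    fix x :: real assume "0 < x"
    then show "\<bar>f x\<bar> \<le> \<bar>a\<bar> + \<bar>b\<bar> + \<bar>B\<bar> + 1"
      using near_0(2)[of x] near_infinity[of x] middle_bound[of x] by (cases "x < \<epsilon>"; cases "x \<ge> N") auto
  qed
qed

text \<open>As \<open>x \<rightarrow> \<infinity>\<close> the difference is of order \<open>x\<^bsup>-m-1\<^esup>\<close>; the exponent \<open>1/2 - m\<close> serves both ends and
  makes the errors at \<open>x = d, 2 d, 3 d, \<dots>\<close> summable with the weights \<open>k\<^bsup>m-2\<^esup>\<close>.\<close>
lemma moment_exp_minus_approx:
  assumes "m \<in> {2, 3, 4}"
  obtains C where "\<And>x. 0 < x \<Longrightarrow>
    \<bar>moment m (exp (- x)) - fact m / x ^ Suc m\<bar> \<le> C * x powr (1/2 - real m)"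
proof -
  define g :: "real \<Rightarrow> real" where "g = (\<lambda>y.
    if m = 2 then y * (1 + y) / (1 - y) ^ 3
    else if m = 3 then y * (1 + 4 * y + y\<^sup>2) / (1 - y) ^ 4
    else y * (1 + 11 * y + 11 * y\<^sup>2 + y ^ 3) / (1 - y) ^ 5)"
  have moment: "moment m (exp (- x)) = g (exp (- x))" if "0 < x" for x
    using assms that by (auto simp: g_def moment_2 moment_3 moment_4)
  define f where "f = (\<lambda>x. x powr (real m - 1/2) * (g (exp (- x)) - fact m / x ^ Suc m))"
  have "continuous_on {0<..} f"
    using assms unfolding f_def g_def by (elim insertE emptyE) (auto intro!: continuous_intros)
  moreover have "(f \<longlongrightarrow> 0) (at_right 0)"
    using assms unfolding f_def g_def
    by (elim insertE emptyE; simp add: fact_numeral eval_nat_numeral del: power_Suc; real_asymp)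
  moreover have "(f \<longlongrightarrow> 0) at_top"
    using assms unfolding f_def g_def
    by (elim insertE emptyE; simp add: fact_numeral eval_nat_numeral del: power_Suc; real_asymp)
  ultimately obtain C where f_bound: "\<And>x. 0 < x \<Longrightarrow> \<bar>f x\<bar> \<le> C"
    using bounded_on_pos_real by blast
  show ?thesis
  proof (rule that)
    fix x :: real assume x_pos: "0 < x"
    then have "moment m (exp (- x)) - fact m / x ^ Suc m = f x * x powr (1/2 - real m)"
      by (simp add: f_def moment mult_ac powr_add[symmetric])
    then show "\<bar>moment m (exp (- x)) - fact m / x ^ Suc m\<bar> \<le> C * x powr (1/2 - real m)"
      using f_bound[OF x_pos] by (simp add: abs_mult mult_right_mono)
  qed
qed

subsection \<open>The logarithm of the generating function\<close>

lemma sums_swap: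
  fixes f :: "nat \<Rightarrow> nat \<Rightarrow> 'a :: banach"
  assumes rows: "\<And>k. summable (\<lambda>j. norm (f k j))" "summable (\<lambda>k. \<Sum>j. norm (f k j))"
    and columns: "\<And>j. (\<lambda>k. f k j) sums c j"
  shows "c sums (\<Sum>k. \<Sum>j. f k j)"
proof -
  have "((\<lambda>j. norm (f k j)) has_sum (\<Sum>j. norm (f k j))) UNIV" for k
    by (rule sums_nonneg_imp_has_sum[OF summable_sums[OF rows(1)]]) simp
  moreover have "(\<lambda>k. \<Sum>j. norm (f k j)) summable_on UNIV"
    using rows by (intro summable_nonneg_imp_summable_on suminf_nonneg) auto
  ultimately have "(\<lambda>p. norm (case_prod f p)) summable_on (UNIV \<times> UNIV)"
    by (intro summable_on_SigmaI[where g = "\<lambda>k. \<Sum>j. norm (f k j)"]) auto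
  then obtain S where double_sum: "(case_prod f has_sum S) (UNIV \<times> UNIV)"
    using abs_summable_summable summable_on_def by blast
  have "((\<lambda>k. \<Sum>j. f k j) has_sum S) UNIV"
    using rows(1)
    by (intro has_sum_SigmaD[OF double_sum] norm_summable_imp_has_sum) (auto intro: summable_norm_cancel)
  then have "S = (\<Sum>k. \<Sum>j. f k j)"
    by (rule sums_unique[OF has_sum_imp_sums])
  moreover have double_sum_swapped: "((\<lambda>(j, k). f k j) has_sum S) (UNIV \<times> UNIV)"
    using double_sum by (subst has_sum_swap) simp
  have "(c has_sum S) UNIV"
  proof (rule has_sum_SigmaD[OF double_sum_swapped])
    fix j
    have "norm (f k j) \<le> (\<Sum>j. norm (f k j))" for k
      using sum_le_suminf[OF rows(1), of "{j}" k] by simp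
    then have "summable (\<lambda>k. norm (f k j))"
      by (intro summable_comparison_test'[OF rows(2), of 0]) simp
    then show "((\<lambda>k. case (j, k) of (j, k) \<Rightarrow> f k j) has_sum c j) UNIV"
      using columns by (auto intro: norm_summable_imp_has_sum)
  qed
  ultimately show ?thesis
    using has_sum_imp_sums by simp
qed

definition log_term :: "nat \<Rightarrow> 'a :: {real_normed_field, banach} \<Rightarrow> 'a" where
  "log_term k x = moment 1 (x ^ Suc k) / of_nat (Suc k)"

definition log_Q :: "'a :: {real_normed_field, banach} \<Rightarrow> 'a" where
  "log_Q x = (\<Sum>k. log_term k x)"

lemma norm_power_Suc_less_one:
  fixes x :: "'a :: real_normed_div_algebra"
  assumes "norm x < 1"
  shows "norm (x ^ Suc k) < 1"
  using power_decreasing[of 1 "Suc k" "norm x"] assms by (simp add: norm_power norm_mult)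

lemma one_minus_power_Suc_nonzero:
  fixes x :: "'a :: real_normed_div_algebra"
  assumes "norm x < 1"
  shows "1 - x ^ Suc k \<noteq> 0"
  using norm_power_Suc_less_one[OF assms, of k] by (metis norm_one less_irrefl right_minus_eq)

lemma norm_log_term_le:
  assumes "norm x \<le> \<rho>" "\<rho> < 1"
  shows "norm (log_term k x) \<le> log_term k \<rho>"
proof -
  have \<rho>_less_one: "norm \<rho> < 1"
    using assms order_trans[OF norm_ge_zero assms(1)] by simp
  have "norm (x ^ Suc k) \<le> \<rho> ^ Suc k"
    unfolding norm_power using assms by (intro power_mono) auto
  moreover have "\<rho> ^ Suc k < 1"
    using norm_power_Suc_less_one[OF \<rho>_less_one, of k] by (simp only: real_norm_def abs_less_iff)
  ultimately show ?thesis
    unfolding log_term_def norm_divide norm_of_nat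
    by (intro divide_right_mono norm_moment_le) auto
qed

lemma log_term_eq:
  assumes "norm x < 1"
  shows "log_term k x = x ^ Suc k / (of_nat (Suc k) * (1 - x ^ Suc k)\<^sup>2)"
  unfolding log_term_def moment_1[OF norm_power_Suc_less_one[OF assms]]
  by (simp add: mult.commute del: power_Suc of_nat_Suc)

lemma log_term_real_le:
  fixes \<rho> :: real
  assumes "0 \<le> \<rho>" "\<rho> < 1"
  shows "log_term k \<rho> \<le> \<rho> ^ Suc k / (1 - \<rho>)\<^sup>2"
proof -
  have power_bounds: "\<rho> ^ Suc k \<le> \<rho>" "0 \<le> \<rho> ^ Suc k"
    using power_decreasing[of 1 "Suc k" \<rho>] assms by auto
  then have "1 * (1 - \<rho>)\<^sup>2 \<le> real (Suc k) * (1 - \<rho> ^ Suc k)\<^sup>2"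
    using assms by (intro mult_mono power_mono) auto
  then have "\<rho> ^ Suc k / (real (Suc k) * (1 - \<rho> ^ Suc k)\<^sup>2) \<le> \<rho> ^ Suc k / (1 - \<rho>)\<^sup>2"
    using assms power_bounds by (intro frac_le) auto
  then show ?thesis
    using assms by (simp only: log_term_eq real_norm_def abs_of_nonneg)
qed

lemma summable_power_Suc_divide:
  fixes y :: "'a :: {real_normed_field, banach}"
  assumes "norm y < 1"
  shows "summable (\<lambda>k. y ^ Suc k / c)"
  using assms by (intro summable_divide) (subst summable_Suc_iff, rule summable_geometric)

lemma summable_norm_log_term:
  assumes "norm x < 1"
  shows "summable (\<lambda>k. norm (log_term k x))"
proof (rule summable_comparison_test'[where N = 0])
  show "summable (\<lambda>k. norm x ^ Suc k / (1 - norm x)\<^sup>2)"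
    using assms by (intro summable_power_Suc_divide) auto
  show "norm (norm (log_term k x)) \<le> norm x ^ Suc k / (1 - norm x)\<^sup>2" for k
    using norm_log_term_le[of x "norm x" k] log_term_real_le[of "norm x" k] assms by simp
qed

lemma log_Q_sums: "norm x < 1 \<Longrightarrow> (\<lambda>k. log_term k x) sums log_Q x"
  unfolding log_Q_def by (rule summable_sums[OF summable_norm_cancel[OF summable_norm_log_term]])

lemma of_real_log_term:
  assumes "\<bar>\<rho>\<bar> < 1"
  shows "log_term k (of_real \<rho>) = of_real (log_term k \<rho>)"
proof -
  have "\<bar>\<rho> ^ Suc k\<bar> < 1"
    using norm_power_Suc_less_one[of \<rho> k] assms by simp
  then show ?thesis
    unfolding log_term_def of_real_divide of_real_of_nat_eq of_real_power[symmetric]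
    by (simp only: of_real_moment)
qed

lemma of_real_log_Q:
  assumes "\<bar>\<rho>\<bar> < 1"
  shows "log_Q (of_real \<rho>) = of_real (log_Q \<rho>)"
  using sums_of_real[OF log_Q_sums[of \<rho>]] assms
  by (intro sums_unique2[OF log_Q_sums]) (simp_all add: of_real_log_term)

lemma ln_one_minus_power_sums:
  fixes x :: complex
  assumes "norm x < 1"
  shows "(\<lambda>k. of_nat j * (x ^ Suc k) ^ j / of_nat (Suc k)) sums (- of_nat j * ln (1 - x ^ j))"
proof (cases j)
  case 0
  then show ?thesis by simp
next
  case (Suc i)
  have "(\<lambda>k. - ((x ^ j) ^ k) / of_nat k) sums ln (1 - x ^ j)"
    using Ln_series'[of "- (x ^ j)"] norm_power_Suc_less_one[OF assms, of i] Suc by simp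
  then have "(\<lambda>k. - ((x ^ j) ^ Suc k) / of_nat (Suc k)) sums ln (1 - x ^ j)"
    by (subst sums_Suc_iff) simp
  from sums_mult[OF this, of "- of_nat j"]
  have "(\<lambda>k. - of_nat j * (- ((x ^ j) ^ Suc k) / of_nat (Suc k))) sums (- of_nat j * ln (1 - x ^ j))" .
  moreover have "- of_nat j * (- ((x ^ j) ^ Suc k) / of_nat (Suc k))
      = of_nat j * (x ^ Suc k) ^ j / of_nat (Suc k)" for k
    by (simp add: power_mult[symmetric] mult.commute del: power_Suc of_nat_Suc)
  ultimately show ?thesis by (simp only:)
qed

lemma Q_eq_exp_log_Q:
  assumes x: "norm x < 1"
  shows "Q x = exp (log_Q x)"
proof -
  define f where "f = (\<lambda>k j. of_nat j ^ 1 * (x ^ Suc k) ^ j / of_nat (Suc k))"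
  have row: "f k sums log_term k x" for k
    unfolding f_def log_term_def by (intro sums_divide moment_sums norm_power_Suc_less_one x)
  have norm_row: "(\<lambda>j. norm (f k j)) sums log_term k (norm x)" for k
    using sums_divide[OF moment_norm_sums[OF norm_power_Suc_less_one[OF x, of k], of 1]]
    unfolding f_def log_term_def norm_divide norm_of_nat by (simp only: norm_power)
  define l where "l = (\<lambda>j. - of_nat j * ln (1 - x ^ j))"
  have column: "(\<lambda>k. f k j) sums l j" for j
    unfolding f_def l_def power_one_right by (rule ln_one_minus_power_sums[OF x])
  have "summable (\<lambda>k. log_term k (norm x))"
    using x by (intro sums_summable[OF log_Q_sums]) simp
  then have "l sums (\<Sum>k. \<Sum>j. f k j)"
    by (intro sums_swap[OF sums_summable[OF norm_row] _ column])
       (simp only: sums_unique[OF norm_row, symmetric])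
  then have "l sums log_Q x"
    by (simp only: log_Q_def sums_unique[OF row, symmetric])
  then have "(\<lambda>j. l (Suc j)) sums log_Q x"
    by (subst sums_Suc_iff) (simp add: l_def)
  moreover have "exp (l (Suc j)) = inverse ((1 - x ^ Suc j) ^ Suc j)" for j
    using one_minus_power_Suc_nonzero[OF x, of j]
    by (simp add: l_def exp_minus exp_of_nat_mult del: power_Suc of_nat_Suc)
  ultimately show ?thesis
    using prodinf_exp[of "\<lambda>j. l (Suc j)"] unfolding Q_def by (simp only: sums_iff)
qed

lemma Q_nonzero: "norm x < 1 \<Longrightarrow> Q x \<noteq> 0"
  by (simp add: Q_eq_exp_log_Q)

lemma holomorphic_log_term: "log_term k holomorphic_on ball 0 1"
proof -
  have "(\<lambda>x. x ^ Suc k / (of_nat (Suc k) * (1 - x ^ Suc k)\<^sup>2) :: complex) holomorphic_on ball 0 1"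
    using one_minus_power_Suc_nonzero[where 'a = complex and k = k]
    by (intro holomorphic_intros) (auto simp del: power_Suc of_nat_Suc)
  then show ?thesis
    by (rule holomorphic_transform) (simp only: log_term_eq mem_ball_0)
qed

lemma holomorphic_log_Q: "log_Q holomorphic_on ball 0 1"
proof (rule holomorphic_uniform_sequence)
  show "(\<lambda>x. \<Sum>k<n. log_term k x) holomorphic_on ball 0 1" for n
    by (intro holomorphic_on_sum holomorphic_log_term)
  fix x :: complex assume x_in_ball: "x \<in> ball 0 1"
  define \<rho> where "\<rho> = (1 + norm x) / 2"
  have \<rho>_bounds: "0 \<le> \<rho>" "\<rho> < 1" "norm x < \<rho>" using x_in_ball by (auto simp: \<rho>_def field_simps)
  have norm_le_\<rho>: "norm y \<le> \<rho>" if "y \<in> cball x (\<rho> - norm x)" for y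
    using that norm_triangle_ineq2[of y x] by (auto simp: dist_norm norm_minus_commute)
  have "uniform_limit (cball x (\<rho> - norm x)) (\<lambda>n x. \<Sum>k<n. log_term k x) log_Q sequentially"
    unfolding log_Q_def[abs_def] using norm_le_\<rho> \<rho>_bounds
    by (intro Weierstrass_m_test[where M = "\<lambda>k. \<rho> ^ Suc k / (1 - \<rho>)\<^sup>2"] summable_power_Suc_divide
        order_trans[OF norm_log_term_le log_term_real_le]) auto
  moreover have "cball x (\<rho> - norm x) \<subseteq> ball 0 1"
    using norm_le_\<rho> \<rho>_bounds by (force simp: dist_norm)
  ultimately show "\<exists>d>0. cball x d \<subseteq> ball 0 1 \<and>
      uniform_limit (cball x d) (\<lambda>n x. \<Sum>k<n. log_term k x) log_Q sequentially"
    using \<rho>_bounds by (intro exI[of _ "\<rho> - norm x"]) auto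
qed auto

lemma holomorphic_Q: "Q holomorphic_on ball 0 1"
  by (rule holomorphic_transform[OF holomorphic_on_exp'[OF holomorphic_log_Q]])
     (simp add: Q_eq_exp_log_Q)

subsection \<open>Decay of the generating function along a circle\<close>

lemma one_minus_cos_ge:
  fixes \<theta> :: real
  assumes "\<bar>\<theta>\<bar> \<le> pi"
  shows "\<theta>\<^sup>2 / 16 \<le> 1 - cos \<theta>"
proof (cases "\<bar>\<theta>\<bar> \<le> 2")
  case True
  have "\<bar>Re (iexp \<theta> - (\<Sum>k\<le>3. (\<i> * \<theta>) ^ k / fact k))\<bar> \<le> \<bar>\<theta>\<bar> ^ 4 / fact 4"
    using iexp_approx1[of \<theta> 3] by (intro order_trans[OF abs_Re_le_cmod]) (simp add: numeral_eq_Suc)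
  also have "Re (iexp \<theta> - (\<Sum>k\<le>3. (\<i> * \<theta>) ^ k / fact k)) = cos \<theta> - 1 + \<theta>\<^sup>2 / 2"
    by (simp add: cis_conv_exp[symmetric] numeral_eq_Suc)
  finally have "\<bar>cos \<theta> - 1 + \<theta>\<^sup>2 / 2\<bar> \<le> \<theta> ^ 4 / 24"
    by (simp add: fact_numeral)
  moreover have "\<theta> ^ 4 \<le> 4 * \<theta>\<^sup>2"
  proof -
    have "\<theta>\<^sup>2 * \<theta>\<^sup>2 \<le> 4 * \<theta>\<^sup>2"
      using power_mono[OF True, of 2] by (intro mult_right_mono) auto
    then show ?thesis by (simp add: power2_eq_square numeral_eq_Suc mult_ac)
  qed
  ultimately show ?thesis
    using zero_le_power2[of \<theta>] by linarith
next
  case False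
  have "cos \<bar>\<theta>\<bar> \<le> cos 2"
    using False assms by (intro cos_monotone_0_pi_le) auto
  then have "cos \<theta> \<le> 0" using cos_two_less_zero by (simp only: cos_abs_real)
  moreover have "\<theta>\<^sup>2 \<le> 4\<^sup>2"
    using assms pi_less_4 by (intro abs_le_square_iff[THEN iffD1]) auto
  ultimately show ?thesis by simp
qed

lemma norm_one_minus_rcis: "(norm (1 - rcis r \<theta>))\<^sup>2 = (1 - r)\<^sup>2 + 2 * r * (1 - cos \<theta>)"
proof -
  have "(norm (1 - rcis r \<theta>))\<^sup>2 = (1 - r * cos \<theta>)\<^sup>2 + r\<^sup>2 * (sin \<theta>)\<^sup>2"
    by (simp add: cmod_power2 power_mult_distrib)
  also have "\<dots> = (1 - r)\<^sup>2 + 2 * r * (1 - cos \<theta>)"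
    unfolding sin_squared_eq by (simp add: power2_eq_square algebra_simps)
  finally show ?thesis .
qed

lemma exp_minus_ge_third:
  fixes d :: real
  assumes "d \<le> 1"
  shows "1 / 3 \<le> exp (- d)"
proof -
  have "exp d \<le> exp 1" using assms by simp
  also have "\<dots> \<le> 3" by (rule exp_le)
  finally show ?thesis by (simp add: exp_minus field_simps)
qed

text \<open>The constant is \<open>72 = 3 \<cdot> 24\<close>, where \<open>e\<^sup>-\<^sup>d \<ge> 1/3\<close> and \<open>2 e\<^sup>-\<^sup>d (1 - cos \<theta>) \<ge> \<theta>\<^sup>2 / 24\<close>.\<close>
definition circle_decay :: "real \<Rightarrow> real \<Rightarrow> real" where
  "circle_decay d \<theta> = \<theta>\<^sup>2 / (72 * d\<^sup>2 * (d\<^sup>2 + \<theta>\<^sup>2))"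

lemma circle_decay_mono:
  assumes "0 < d" "\<bar>\<theta>\<bar> \<le> \<bar>\<phi>\<bar>"
  shows "circle_decay d \<theta> \<le> circle_decay d \<phi>"
proof -
  have "d\<^sup>2 * \<theta>\<^sup>2 \<le> d\<^sup>2 * \<phi>\<^sup>2"
    using assms by (intro mult_left_mono) (simp_all add: abs_le_square_iff)
  then have "\<theta>\<^sup>2 * (d\<^sup>2 + \<phi>\<^sup>2) \<le> \<phi>\<^sup>2 * (d\<^sup>2 + \<theta>\<^sup>2)"
    by (simp add: algebra_simps)
  then have "\<theta>\<^sup>2 / (d\<^sup>2 + \<theta>\<^sup>2) \<le> \<phi>\<^sup>2 / (d\<^sup>2 + \<phi>\<^sup>2)"
    using assms by (simp add: pos_divide_le_eq pos_le_divide_eq add_pos_nonneg)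
  then have "1 / (72 * d\<^sup>2) * (\<theta>\<^sup>2 / (d\<^sup>2 + \<theta>\<^sup>2)) \<le> 1 / (72 * d\<^sup>2) * (\<phi>\<^sup>2 / (d\<^sup>2 + \<phi>\<^sup>2))"
    by (rule mult_left_mono) simp
  then show ?thesis by (simp add: circle_decay_def)
qed

lemma circle_decay_le_diff:
  assumes d: "0 < d" "d \<le> 1" and \<theta>: "\<bar>\<theta>\<bar> \<le> pi"
  defines "A \<equiv> (1 - exp (- d))\<^sup>2" and "B \<equiv> 2 * exp (- d) * (1 - cos \<theta>)"
  shows "circle_decay d \<theta> \<le> exp (- d) / A - exp (- d) / (A + B)"
proof -
  have exp_ge_third: "1 / 3 \<le> exp (- d)" by (rule exp_minus_ge_third[OF d(2)])
  have A_pos: "0 < A" using d by (simp add: A_def)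
  have A_le: "A \<le> d\<^sup>2"
    unfolding A_def using d exp_ge_add_one_self[of "- d"] by (intro power_mono) auto
  have B_nonneg: "0 \<le> B" by (simp add: B_def)
  have "2 / 3 * (\<theta>\<^sup>2 / 16) \<le> B"
    unfolding B_def using exp_ge_third one_minus_cos_ge[OF \<theta>] by (intro mult_mono) auto
  then have B_ge: "\<theta>\<^sup>2 \<le> 24 * B" by simp
  have "(1 / 3) / d\<^sup>2 \<le> exp (- d) / A"
    using exp_ge_third A_pos A_le by (intro frac_le) auto
  moreover have "\<theta>\<^sup>2 / (24 * (d\<^sup>2 + \<theta>\<^sup>2)) \<le> B / (A + B)"
  proof -
    have "\<theta>\<^sup>2 * A \<le> 24 * B * d\<^sup>2" using B_ge A_le A_pos B_nonneg by (intro mult_mono) auto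
    moreover have "\<theta>\<^sup>2 * B \<le> 24 * B * \<theta>\<^sup>2"
      using mult_nonneg_nonneg[OF B_nonneg zero_le_power2[of \<theta>]] by (simp add: mult.commute)
    ultimately have "\<theta>\<^sup>2 * (A + B) \<le> B * (24 * (d\<^sup>2 + \<theta>\<^sup>2))"
      by (simp add: algebra_simps)
    moreover have "0 < 24 * (d\<^sup>2 + \<theta>\<^sup>2)" "0 < A + B"
      using A_pos B_nonneg d by (auto simp: add_pos_nonneg)
    ultimately show ?thesis
      by (simp only: pos_divide_le_eq times_divide_eq_left pos_le_divide_eq)
  qed
  moreover have "circle_decay d \<theta> = (1 / 3) / d\<^sup>2 * (\<theta>\<^sup>2 / (24 * (d\<^sup>2 + \<theta>\<^sup>2)))"
    by (simp add: circle_decay_def)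
  ultimately have "circle_decay d \<theta> \<le> exp (- d) / A * (B / (A + B))"
    using A_pos by (simp only:) (intro mult_mono; simp)
  also have "\<dots> = exp (- d) / A - exp (- d) / (A + B)"
    using A_pos B_nonneg by (simp add: field_simps)
  finally show ?thesis .
qed

lemma norm_log_term_0_rcis_le:
  assumes "0 < d" "d \<le> 1" "\<bar>\<theta>\<bar> \<le> pi"
  shows "norm (log_term 0 (rcis (exp (- d)) \<theta>)) \<le> log_term 0 (exp (- d)) - circle_decay d \<theta>"
proof -
  have "norm (log_term 0 (rcis (exp (- d)) \<theta>))
      = exp (- d) / ((1 - exp (- d))\<^sup>2 + 2 * exp (- d) * (1 - cos \<theta>))"
    using assms
    by (simp add: log_term_eq norm_divide norm_power norm_one_minus_rcis)
  moreover have "log_term 0 (exp (- d)) = exp (- d) / (1 - exp (- d))\<^sup>2"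
    using assms by (simp add: log_term_eq)
  ultimately show ?thesis
    using circle_decay_le_diff[OF assms] by linarith
qed

lemma norm_log_Q_le:
  assumes x: "norm x < 1"
  shows "norm (log_Q x) \<le> log_Q (norm x) - (log_term 0 (norm x) - norm (log_term 0 x))"
proof -
  have tail: "(\<lambda>k. log_term (Suc k) y) sums (log_Q y - log_term 0 y)"
    if "norm y < 1" for y :: "'b :: {real_normed_field, banach}"
    using log_Q_sums[OF that] by (subst sums_Suc_iff) simp
  have "norm (log_Q x - log_term 0 x) \<le> log_Q (norm x) - log_term 0 (norm x)"
    using x by (intro norm_sums_le[OF tail tail] norm_log_term_le) auto
  then show ?thesis
    using norm_triangle_ineq2[of "log_Q x" "log_term 0 x"] by linarith
qed

lemma norm_Q_ratio_le:
  assumes "0 < d" "d \<le> 1" "\<bar>\<theta>\<bar> \<le> pi"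
  shows "norm (Q (rcis (exp (- d)) \<theta>) / Q (of_real (exp (- d)))) \<le> exp (- circle_decay d \<theta>)"
proof -
  have "Re (log_Q (rcis (exp (- d)) \<theta>)) \<le> norm (log_Q (rcis (exp (- d)) \<theta>))"
    by (rule complex_Re_le_cmod)
  also have "\<dots> \<le> log_Q (exp (- d)) - circle_decay d \<theta>"
    using norm_log_Q_le[of "rcis (exp (- d)) \<theta>"] norm_log_term_0_rcis_le[OF assms] assms by simp
  finally show ?thesis
    using assms by (simp add: Q_eq_exp_log_Q norm_divide of_real_log_Q exp_diff[symmetric])
qed

subsection \<open>Expansion near the positive axis\<close>

lemma zeta_sums:
  assumes "1 < s"
  shows "(\<lambda>k. 1 / real (Suc k) powr s) sums zeta s"
proof -
  have "summable (\<lambda>k. real (Suc k) powr - s)"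
    using summable_real_powr_iff[of "- s"] summable_Suc_iff[of "\<lambda>k. real k powr - s"] assms
    by (simp del: of_nat_Suc)
  then show ?thesis
    unfolding zeta_def by (intro summable_sums) (simp add: powr_minus_divide)
qed

lemma zeta_pos:
  assumes "1 < s"
  shows "0 < zeta s"
  unfolding zeta_def by (rule suminf_pos[OF sums_summable[OF zeta_sums[OF assms]]]) simp

lemma scaled_term_approx:
  fixes g :: "real \<Rightarrow> real" and p :: nat
  assumes g: "\<And>x. 0 < x \<Longrightarrow> \<bar>g x - a / x ^ (p + 3)\<bar> \<le> C * x powr (- real p - 3/2)"
    and pos: "0 < K" "0 < d"
  shows "\<bar>K ^ p * g (K * d) - a / d ^ (p + 3) * (1 / K powr 3)\<bar>
           \<le> C * (1 / K powr (3/2)) * d powr (- real p - 3/2)"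
proof -
  have "K ^ p * (a / (K * d) ^ (p + 3)) = a / d ^ (p + 3) * (1 / K powr 3)"
    using pos by (simp add: power_mult_distrib power_add)
  then have "K ^ p * g (K * d) - a / d ^ (p + 3) * (1 / K powr 3)
      = K ^ p * (g (K * d) - a / (K * d) ^ (p + 3))"
    by (simp only: right_diff_distrib)
  then have "\<bar>K ^ p * g (K * d) - a / d ^ (p + 3) * (1 / K powr 3)\<bar>
      = K ^ p * \<bar>g (K * d) - a / (K * d) ^ (p + 3)\<bar>"
    using pos by (simp add: abs_mult)
  also have "\<dots> \<le> K ^ p * (C * (K * d) powr (- real p - 3/2))"
    using g[of "K * d"] pos by (intro mult_left_mono) auto
  also have "\<dots> = C * (K powr real p * K powr (- real p - 3/2)) * d powr (- real p - 3/2)"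
    using pos by (simp add: powr_mult powr_realpow)
  also have "K powr real p * K powr (- real p - 3/2) = 1 / K powr (3/2)"
    by (simp add: powr_add[symmetric] powr_minus_divide[symmetric])
  finally show ?thesis .
qed

lemma scaled_sum_approx:
  fixes g :: "real \<Rightarrow> real" and p :: nat
  assumes g: "\<And>x. 0 < x \<Longrightarrow> \<bar>g x - a / x ^ (p + 3)\<bar> \<le> C * x powr (- real p - 3/2)"
    and d: "0 < d"
  defines "S \<equiv> \<Sum>k. real (Suc k) ^ p * g (real (Suc k) * d)"
  shows "(\<lambda>k. real (Suc k) ^ p * g (real (Suc k) * d)) sums S"
    and "\<bar>S - a * zeta 3 / d ^ (p + 3)\<bar> \<le> C * zeta (3/2) * d powr (- real p - 3/2)"
proof -
  define f where "f = (\<lambda>k. real (Suc k) ^ p * g (real (Suc k) * d))"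
  define main where "main = (\<lambda>k. a / d ^ (p + 3) * (1 / real (Suc k) powr 3))"
  have error_le:
    "norm (f k - main k) \<le> C * (1 / real (Suc k) powr (3/2)) * d powr (- real p - 3/2)" for k
    unfolding f_def main_def real_norm_def by (rule scaled_term_approx[OF g _ d]) simp_all
  have bound_sums: "(\<lambda>k. C * (1 / real (Suc k) powr (3/2)) * d powr (- real p - 3/2))
      sums (C * zeta (3/2) * d powr (- real p - 3/2))"
    by (intro sums_mult sums_mult2 zeta_sums) simp
  then have "summable (\<lambda>k. f k - main k)"
    using error_le by (blast intro: summable_comparison_test' sums_summable)
  then have error_sums: "(\<lambda>k. f k - main k) sums (\<Sum>k. f k - main k)"
    by (rule summable_sums)
  moreover have "main sums (a / d ^ (p + 3) * zeta 3)"
    unfolding main_def by (intro sums_mult zeta_sums) simp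
  ultimately have "(\<lambda>k. (f k - main k) + main k) sums ((\<Sum>k. f k - main k) + a / d ^ (p + 3) * zeta 3)"
    by (rule sums_add)
  then have f_sums: "f sums ((\<Sum>k. f k - main k) + a / d ^ (p + 3) * zeta 3)"
    by (simp only: diff_add_cancel)
  then show "(\<lambda>k. real (Suc k) ^ p * g (real (Suc k) * d)) sums S"
    unfolding S_def f_def[symmetric] by (rule summable_sums[OF sums_summable])
  have "S - a * zeta 3 / d ^ (p + 3) = (\<Sum>k. f k - main k)"
    unfolding S_def f_def[symmetric] sums_unique[OF f_sums, symmetric] by simp
  then show "\<bar>S - a * zeta 3 / d ^ (p + 3)\<bar> \<le> C * zeta (3/2) * d powr (- real p - 3/2)"
    using norm_sums_le[OF error_sums bound_sums error_le] by simp
qed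

text \<open>\<open>\<i>\<^bsup>p+1\<^esup> log_Q_moment p d\<close> is the derivative of order \<open>p + 1\<close> of \<open>log_Q (e\<^bsup>-d+\<i>\<theta>\<^esup>)\<close> at \<open>\<theta> = 0\<close>.\<close>
definition log_Q_moment :: "nat \<Rightarrow> real \<Rightarrow> real" where
  "log_Q_moment p d = (\<Sum>k. real (Suc k) ^ p * moment (p + 2) (exp (- (real (Suc k) * d))))"

lemma log_Q_moment_approx:
  assumes "p \<le> 2"
  obtains C where
    "\<And>d. 0 < d \<Longrightarrow>
      (\<lambda>k. real (Suc k) ^ p * moment (p + 2) (exp (- (real (Suc k) * d)))) sums log_Q_moment p d"
    "\<And>d. 0 < d \<Longrightarrow>
      \<bar>log_Q_moment p d - fact (p + 2) * zeta 3 / d ^ (p + 3)\<bar> \<le> C * d powr (- real p - 3/2)"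
proof -
  have "p + 2 \<in> {2, 3, 4}" using assms by auto
  from moment_exp_minus_approx[OF this] obtain C where moment_error_le: "\<And>x. 0 < x \<Longrightarrow>
      \<bar>moment (p + 2) (exp (- x)) - fact (p + 2) / x ^ (p + 3)\<bar> \<le> C * x powr (- real p - 3/2)"
    by (auto simp: algebra_simps numeral_3_eq_3)
  show ?thesis
    using scaled_sum_approx[where g = "\<lambda>x. moment (p + 2) (exp (- x))", OF moment_error_le]
    by (intro that[of "C * zeta (3/2)"]) (simp_all only: log_Q_moment_def)
qed

lemma log_Q_moment_tendsto:
  assumes "p \<le> 2"
  shows "((\<lambda>d. d ^ (2 * p + 2) * (log_Q_moment p d - fact (p + 2) * zeta 3 / d ^ (p + 3)))
           \<longlongrightarrow> 0) (at_right 0)"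
proof -
  obtain C where moment_error_le: "\<And>d. 0 < d \<Longrightarrow>
      \<bar>log_Q_moment p d - fact (p + 2) * zeta 3 / d ^ (p + 3)\<bar> \<le> C * d powr (- real p - 3/2)"
    using log_Q_moment_approx[OF assms] by metis
  show ?thesis
  proof (rule Lim_null_comparison)
    show "\<forall>\<^sub>F d in at_right 0.
        norm (d ^ (2 * p + 2) * (log_Q_moment p d - fact (p + 2) * zeta 3 / d ^ (p + 3)))
          \<le> C * d powr (real p + 1/2)"
      using eventually_at_right_less[of 0]
    proof eventually_elim
      case (elim d)
      have "norm (d ^ (2 * p + 2) * (log_Q_moment p d - fact (p + 2) * zeta 3 / d ^ (p + 3)))
          \<le> d ^ (2 * p + 2) * (C * d powr (- real p - 3/2))"
        using elim
          mult_left_mono[OF moment_error_le[OF elim] zero_le_power[OF less_imp_le[OF elim]], of "2 * p + 2"]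
        by (simp only: real_norm_def abs_mult power_abs abs_of_pos)
      also have "\<dots> = C * (d powr real (2 * p + 2) * d powr (- real p - 3/2))"
        by (simp only: powr_realpow[OF elim] mult.left_commute)
      also have "\<dots> = C * d powr (real p + 1/2)"
        by (simp add: powr_add[symmetric])
      finally show ?case .
    qed
    show "((\<lambda>d. C * d powr (real p + 1/2)) \<longlongrightarrow> 0) (at_right 0)"
      by real_asymp
  qed
qed

lemma log_term_rcis_sums:
  assumes "0 < d"
  shows "(\<lambda>j. of_real (real j * exp (- (real (Suc k) * d)) ^ j / real (Suc k))
             * cis (real j * (real (Suc k) * \<theta>)))
           sums log_term k (rcis (exp (- d)) \<theta>)"
proof -
  have rcis_power: "rcis (exp (- d)) \<theta> ^ Suc k = rcis (exp (- (real (Suc k) * d))) (real (Suc k) * \<theta>)"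
    unfolding DeMoivre2 by (simp add: exp_of_nat_mult[symmetric] del: of_nat_Suc power_Suc)
  have "(\<lambda>j. of_nat j ^ 1 * (rcis (exp (- (real (Suc k) * d))) (real (Suc k) * \<theta>)) ^ j / of_nat (Suc k))
      sums log_term k (rcis (exp (- d)) \<theta>)"
    unfolding log_term_def rcis_power using assms by (intro sums_divide moment_sums) simp
  then show ?thesis
    by (simp add: rcis_def power_mult_distrib Complex.DeMoivre mult_ac del: of_nat_Suc)
qed

lemma norm_scaled_cis_taylor_2:
  assumes "0 \<le> c"
  shows "norm (of_real c * cis x - of_real c - \<i> * of_real (c * x) + of_real (c * x\<^sup>2 / 2))
           \<le> c * \<bar>x\<bar> ^ 3 / 6"
proof -
  have "norm (cis x - 1 - \<i> * of_real x + of_real (x\<^sup>2 / 2)) \<le> \<bar>x\<bar> ^ 3 / 6"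
    using iexp_approx1[of x 2] by (simp add: numeral_eq_Suc cis_conv_exp algebra_simps)
  then have "c * norm (cis x - 1 - \<i> * of_real x + of_real (x\<^sup>2 / 2)) \<le> c * (\<bar>x\<bar> ^ 3 / 6)"
    using assms by (rule mult_left_mono)
  also have "c * norm (cis x - 1 - \<i> * of_real x + of_real (x\<^sup>2 / 2))
      = norm (of_real c * (cis x - 1 - \<i> * of_real x + of_real (x\<^sup>2 / 2)))"
    using assms by (simp only: norm_mult norm_of_real abs_of_nonneg)
  finally show ?thesis by (simp add: algebra_simps)
qed

lemma log_term_taylor:
  fixes d \<theta> :: real and k :: nat
  assumes d: "0 < d"
  defines "K \<equiv> real (Suc k)"
  shows "norm (log_term k (rcis (exp (- d)) \<theta>) - log_term k (of_real (exp (- d)))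
            - \<i> * of_real (\<theta> * moment 2 (exp (- (K * d))))
            + of_real (\<theta>\<^sup>2 / 2 * (K * moment 3 (exp (- (K * d))))))
        \<le> \<bar>\<theta>\<bar> ^ 3 / 6 * (K\<^sup>2 * moment 4 (exp (- (K * d))))"
proof -
  define y where "y = exp (- (K * d))"
  define c where "c = (\<lambda>j. real j * y ^ j / K)"
  define x where "x = (\<lambda>j. real j * (K * \<theta>))"
  have K_pos: "0 < K" by (simp add: K_def)
  have y_bounds: "0 < y" "norm y < 1" using K_pos d by (auto simp: y_def)
  have c_nonneg: "0 \<le> c j" for j using K_pos y_bounds by (simp add: c_def)
  have rotated: "(\<lambda>j. of_real (c j) * cis (x j)) sums log_term k (rcis (exp (- d)) \<theta>)"
    using log_term_rcis_sums[OF d, of k \<theta>] unfolding c_def x_def y_def K_def .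
  have center: "(\<lambda>j. of_real (c j)) sums log_term k (of_real (exp (- d)) :: complex)"
    using log_term_rcis_sums[OF d, of k 0] unfolding c_def y_def K_def by (simp del: of_nat_Suc)
  have first: "(\<lambda>j. c j * x j) sums (\<theta> * moment 2 y)"
    using sums_mult[OF moment_sums[OF y_bounds(2), of 2], of \<theta>] K_pos
    by (simp add: c_def x_def power2_eq_square mult_ac)
  have second: "(\<lambda>j. c j * (x j)\<^sup>2 / 2) sums (\<theta>\<^sup>2 / 2 * (K * moment 3 y))"
    using sums_mult[OF moment_sums[OF y_bounds(2), of 3], of "\<theta>\<^sup>2 / 2 * K"] K_pos
    by (simp add: c_def x_def power2_eq_square power3_eq_cube mult_ac)
  have third: "(\<lambda>j. c j * \<bar>x j\<bar> ^ 3 / 6) sums (\<bar>\<theta>\<bar> ^ 3 / 6 * (K\<^sup>2 * moment 4 y))"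
    using sums_mult[OF moment_sums[OF y_bounds(2), of 4], of "\<bar>\<theta>\<bar> ^ 3 / 6 * K\<^sup>2"] K_pos
    by (simp add: c_def x_def abs_mult eval_nat_numeral mult_ac del: abs_mult_self_eq)
  show ?thesis
    unfolding y_def[symmetric]
    by (rule norm_sums_le[OF sums_add[OF sums_diff[OF sums_diff[OF rotated center]
            sums_mult[OF sums_of_real[OF first]]] sums_of_real[OF second]] third
            norm_scaled_cis_taylor_2[OF c_nonneg]])
qed

lemma log_Q_taylor:
  assumes d: "0 < d"
  shows "norm (log_Q (rcis (exp (- d)) \<theta>) - log_Q (of_real (exp (- d)))
            - \<i> * of_real (\<theta> * log_Q_moment 0 d) + of_real (\<theta>\<^sup>2 / 2 * log_Q_moment 1 d))
        \<le> \<bar>\<theta>\<bar> ^ 3 / 6 * log_Q_moment 2 d"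
proof -
  have moment_sums:
    "(\<lambda>k. real (Suc k) ^ p * moment (p + 2) (exp (- (real (Suc k) * d)))) sums log_Q_moment p d"
    if "p \<le> 2" for p
    using log_Q_moment_approx[OF that] d by metis
  have moments: "(\<lambda>k. moment 2 (exp (- (real (Suc k) * d)))) sums log_Q_moment 0 d"
    "(\<lambda>k. real (Suc k) * moment 3 (exp (- (real (Suc k) * d)))) sums log_Q_moment 1 d"
    "(\<lambda>k. (real (Suc k))\<^sup>2 * moment 4 (exp (- (real (Suc k) * d)))) sums log_Q_moment 2 d"
    using moment_sums[of 0] moment_sums[of 1] moment_sums[of 2] by (simp_all add: eval_nat_numeral)
  have log_Q: "(\<lambda>k. log_term k (rcis (exp (- d)) \<theta>)) sums log_Q (rcis (exp (- d)) \<theta>)"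
    "(\<lambda>k. log_term k (of_real (exp (- d)))) sums log_Q (of_real (exp (- d)) :: complex)"
    using d by (auto intro!: log_Q_sums)
  show ?thesis
    by (rule norm_sums_le[OF sums_add[OF sums_diff[OF sums_diff[OF log_Q]
            sums_mult[OF sums_of_real[OF sums_mult[OF moments(1)]]]]
            sums_of_real[OF sums_mult[OF moments(2)]]] sums_mult[OF moments(3)] log_term_taylor[OF d]])
qed

lemma log_Q_increment_tendsto:
  "((\<lambda>d. log_Q (rcis (exp (- d)) (d\<^sup>2 * u)) - log_Q (of_real (exp (- d)))
          - \<i> * of_real (2 * zeta 3 * u / d))
     \<longlongrightarrow> of_real (- (3 * zeta 3 * u\<^sup>2))) (at_right 0)"
proof -
  define X where "X = (\<lambda>d. log_Q (rcis (exp (- d)) (d\<^sup>2 * u)) - log_Q (of_real (exp (- d))))"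
  define E where
    "E = (\<lambda>p d. d ^ (2 * p + 2) * (log_Q_moment p d - fact (p + 2) * zeta 3 / d ^ (p + 3)))"
  have E_tendsto: "(E p \<longlongrightarrow> 0) (at_right 0)" if "p \<le> 2" for p
    unfolding E_def by (rule log_Q_moment_tendsto[OF that])
  define Y where "Y = (\<lambda>d. X d - \<i> * of_real (u * (E 0 d + 2 * zeta 3 / d))
      + of_real (u\<^sup>2 / 2 * (E 1 d + 6 * zeta 3)))"
  have "(Y \<longlongrightarrow> 0) (at_right 0)"
  proof (rule Lim_null_comparison)
    have "((\<lambda>d. \<bar>u\<bar> ^ 3 / 6 * (E 2 d + 24 * zeta 3 * d))
        \<longlongrightarrow> \<bar>u\<bar> ^ 3 / 6 * (0 + 24 * zeta 3 * 0)) (at_right 0)"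
      by (intro tendsto_intros E_tendsto) simp
    then show "((\<lambda>d. \<bar>u\<bar> ^ 3 / 6 * (E 2 d + 24 * zeta 3 * d)) \<longlongrightarrow> 0) (at_right 0)" by simp
    show "\<forall>\<^sub>F d in at_right 0. norm (Y d) \<le> \<bar>u\<bar> ^ 3 / 6 * (E 2 d + 24 * zeta 3 * d)"
      using eventually_at_right_less[of 0]
    proof eventually_elim
      case (elim d)
      have "d\<^sup>2 * u * log_Q_moment 0 d = u * (E 0 d + 2 * zeta 3 / d)"
        "(d\<^sup>2 * u)\<^sup>2 / 2 * log_Q_moment 1 d = u\<^sup>2 / 2 * (E 1 d + 6 * zeta 3)"
        "\<bar>d\<^sup>2 * u\<bar> ^ 3 / 6 * log_Q_moment 2 d = \<bar>u\<bar> ^ 3 / 6 * (E 2 d + 24 * zeta 3 * d)"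
        using elim by (simp_all add: E_def fact_numeral abs_mult field_simps eval_nat_numeral)
      then show ?case
        using log_Q_taylor[OF elim, of "d\<^sup>2 * u"] by (simp only: Y_def X_def)
    qed
  qed
  then have "((\<lambda>d. Y d + \<i> * of_real (u * E 0 d) - of_real (u\<^sup>2 / 2 * (E 1 d + 6 * zeta 3)))
      \<longlongrightarrow> 0 + \<i> * of_real (u * 0) - of_real (u\<^sup>2 / 2 * (0 + 6 * zeta 3))) (at_right 0)"
    by (intro tendsto_intros E_tendsto) simp_all
  then show ?thesis
    by (simp add: Y_def X_def algebra_simps)
qed

lemma Q_ratio_tendsto:
  fixes d :: "'b \<Rightarrow> real" and m :: "'b \<Rightarrow> nat"
  assumes d: "filterlim d (at_right 0) F"
    and saddle: "((\<lambda>n. 2 * zeta 3 / d n - real (m n) * d n ^ 2) \<longlongrightarrow> 0) F"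
  shows "((\<lambda>n. Q (rcis (exp (- d n)) (d n ^ 2 * u)) / Q (of_real (exp (- d n)))
               * cis (- (real (m n) * (d n ^ 2 * u))))
         \<longlongrightarrow> of_real (exp (- (3 * zeta 3 * u\<^sup>2)))) F"
proof -
  define X where "X = (\<lambda>n. log_Q (rcis (exp (- d n)) (d n ^ 2 * u)) - log_Q (of_real (exp (- d n))))"
  have "((\<lambda>n. X n - \<i> * of_real (2 * zeta 3 * u / d n)) \<longlongrightarrow> of_real (- (3 * zeta 3 * u\<^sup>2))) F"
    unfolding X_def by (rule filterlim_compose[OF log_Q_increment_tendsto d])
  moreover have "((\<lambda>n. \<i> * of_real (u * (2 * zeta 3 / d n - real (m n) * d n ^ 2)))
      \<longlongrightarrow> \<i> * of_real (u * 0)) F"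
    by (intro tendsto_intros saddle)
  ultimately have "((\<lambda>n. (X n - \<i> * of_real (2 * zeta 3 * u / d n))
        + \<i> * of_real (u * (2 * zeta 3 / d n - real (m n) * d n ^ 2)))
      \<longlongrightarrow> of_real (- (3 * zeta 3 * u\<^sup>2)) + \<i> * of_real (u * 0)) F"
    by (rule tendsto_add)
  moreover have "X n - \<i> * of_real (2 * zeta 3 * u / d n)
        + \<i> * of_real (u * (2 * zeta 3 / d n - real (m n) * d n ^ 2))
      = X n + \<i> * of_real (- (real (m n) * (d n ^ 2 * u)))" for n
    by (simp add: algebra_simps)
  ultimately have "((\<lambda>n. exp (X n + \<i> * of_real (- (real (m n) * (d n ^ 2 * u)))))
      \<longlongrightarrow> exp (of_real (- (3 * zeta 3 * u\<^sup>2)))) F"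
    by (intro tendsto_exp) (simp only: mult_zero_right of_real_0 add_0_right)
  moreover have "\<forall>\<^sub>F n in F. 0 < d n"
    using d by (auto simp: filterlim_at elim: eventually_mono)
  then have "\<forall>\<^sub>F n in F. exp (X n + \<i> * of_real (- (real (m n) * (d n ^ 2 * u))))
     = Q (rcis (exp (- d n)) (d n ^ 2 * u)) / Q (of_real (exp (- d n)))
         * cis (- (real (m n) * (d n ^ 2 * u)))"
    unfolding exp_add X_def exp_diff cis_conv_exp by eventually_elim (simp add: Q_eq_exp_log_Q)
  ultimately show ?thesis
    unfolding exp_of_real by (rule Lim_transform_eventually)
qed

subsection \<open>The scaled Cauchy integral\<close>

lemma integral_periodic_shift:
  fixes f :: "real \<Rightarrow> 'a :: euclidean_space"
  assumes cont: "continuous_on UNIV f" and periodic: "\<And>t. f (t + p) = f t" and c: "0 \<le> c" "c \<le> p"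
  shows "integral {0..p} f = integral {c - p..c} f"
proof -
  have integrable: "f integrable_on {a..b}" for a b
    by (intro integrable_continuous_real continuous_on_subset[OF cont]) simp
  have "integral {c..p} f = integral {c - p..0} f"
    using integral_shift_Icc_real[of "c - p" 0 f p] periodic by (simp add: o_def add.commute)
  moreover have "integral {0..c} f + integral {c..p} f = integral {0..p} f"
    using c integrable by (intro Henstock_Kurzweil_Integration.integral_combine)
  moreover have "integral {c - p..0} f + integral {0..c} f = integral {c - p..c} f"
    using c integrable by (intro Henstock_Kurzweil_Integration.integral_combine) auto
  ultimately show ?thesis by (simp add: add.commute)
qed

lemma cis_minus_of_nat_periodic: "cis (- (real n * (t + 2 * pi))) = cis (- (real n * t))"
proof -
  have "cis (- (real n * (t + 2 * pi))) = cis (- (real n * t)) * cis (2 * pi * (- real n))"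
    by (simp add: cis_mult algebra_simps)
  also have "cis (2 * pi * (- real n)) = 1"
    by (intro cis_multiple_2pi) auto
  finally show ?thesis by simp
qed

lemma has_integral_circle_ps_coeff:
  assumes f: "f holomorphic_on ball 0 R" and r: "0 < r" "r < R"
  shows "((\<lambda>t. f (rcis r t) * cis (- (real n * t)))
           has_integral of_real (2 * pi * r ^ n) * ps_coeff n f) {0..2 * pi}"
proof -
  have "cball 0 r \<subseteq> (ball 0 R :: complex set)" using r by auto
  then have "((\<lambda>u. f u / (u - 0) ^ Suc n) has_contour_integral
          (2 * pi * \<i> / fact n * (deriv ^^ n) f 0)) (circlepath 0 r)"
    using r by (intro Cauchy_has_contour_integral_higher_derivative_circlepath)
      (auto intro: continuous_on_subset[OF holomorphic_on_imp_continuous_on[OF f]]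
        holomorphic_on_subset[OF f])
  then have "((\<lambda>t. f (rcis r t) / rcis r t ^ Suc n * of_real r * \<i> * cis t)
               has_integral (2 * pi * \<i> / fact n * (deriv ^^ n) f 0)) {0..2 * pi}"
    unfolding circlepath_def
    by (subst (asm) has_contour_integral_part_circlepath_iff) (auto simp: rcis_def)
  from has_integral_mult_right[OF this, of "of_real (r ^ n) / \<i>"]
  have "((\<lambda>t. of_real (r ^ n) / \<i> * (f (rcis r t) / rcis r t ^ Suc n * of_real r * \<i> * cis t))
               has_integral of_real (2 * pi * r ^ n) * ps_coeff n f) {0..2 * pi}"
    by (simp add: ps_coeff_def fps_expansion_def field_simps)
  moreover have "of_real (r ^ n) / \<i> * (f (rcis r t) / rcis r t ^ Suc n * of_real r * \<i> * cis t)
      = f (rcis r t) * cis (- (real n * t))" for t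
  proof -
    have "cis (- (real n * t)) = inverse (cis t ^ n)"
      by (simp add: Complex.DeMoivre)
    then show ?thesis
      using r by (simp add: rcis_def power_mult_distrib field_simps)
  qed
  ultimately show ?thesis by (simp only:)
qed

lemma ps_coeff_eq_circle_integral:
  assumes f: "f holomorphic_on ball 0 R" and r: "0 < r" "r < R"
  shows "of_real (2 * pi * r ^ n) * ps_coeff n f
           = integral {-pi..pi} (\<lambda>t. f (rcis r t) * cis (- (real n * t)))"
proof -
  have "continuous_on UNIV (\<lambda>t. f (rcis r t) * cis (- (real n * t)))"
    using r
    by (intro continuous_intros continuous_on_compose2[OF holomorphic_on_imp_continuous_on[OF f]]) auto
  from integral_periodic_shift[OF this, of "2 * pi" pi]
  have "integral {0..2 * pi} (\<lambda>t. f (rcis r t) * cis (- (real n * t)))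
      = integral {-pi..pi} (\<lambda>t. f (rcis r t) * cis (- (real n * t)))"
    by (simp only: cis_minus_of_nat_periodic) (simp add: rcis_def cis_mult[symmetric])
  with has_integral_circle_ps_coeff[OF f r, of n] show ?thesis
    by (simp only: integral_unique)
qed

definition circle_kernel :: "real \<Rightarrow> nat \<Rightarrow> real \<Rightarrow> complex" where
  "circle_kernel d n u = indicator {-pi..pi} (d\<^sup>2 * u) *\<^sub>R
     (Q (rcis (exp (- d)) (d\<^sup>2 * u)) / Q (of_real (exp (- d))) * cis (- (real n * (d\<^sup>2 * u))))"

definition arc_integral :: "real set \<Rightarrow> (complex \<Rightarrow> complex) \<Rightarrow> real \<Rightarrow> nat \<Rightarrow> complex" where
  "arc_integral A f d n =
     (LINT u|lborel. indicator A (d\<^sup>2 * u) *\<^sub>R (circle_kernel d n u * f (rcis (exp (- d)) (d\<^sup>2 * u))))"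

definition circle_scale :: "real \<Rightarrow> nat \<Rightarrow> complex" where
  "circle_scale d n = of_real (d\<^sup>2 / (2 * pi * exp (- d) ^ n)) * Q (of_real (exp (- d)))"

lemma circle_scale_nonzero: "0 < d \<Longrightarrow> circle_scale d n \<noteq> 0"
  using Q_nonzero[of "of_real (exp (- d))"] by (simp add: circle_scale_def)

lemma ps_coeff_Q_mult:
  assumes f: "f holomorphic_on ball 0 1" and d: "0 < d"
  shows "ps_coeff n (\<lambda>x. Q x * f x) = circle_scale d n * arc_integral UNIV f d n"
proof -
  define r where "r = exp (- d)"
  have r_bounds: "0 < r" "r < 1" using d by (auto simp: r_def)
  have Q_r_nonzero: "Q (of_real r) \<noteq> 0" using r_bounds by (intro Q_nonzero) simp
  have holomorphic_Q_f: "(\<lambda>x. Q x * f x) holomorphic_on ball 0 1"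
    by (intro holomorphic_intros holomorphic_Q f)
  define G where "G = (\<lambda>t. Q (rcis r t) * f (rcis r t) * cis (- (real n * t)))"
  have continuous_G: "continuous_on {-pi..pi} G"
    unfolding G_def using r_bounds
    by (intro continuous_intros
        continuous_on_compose2[OF holomorphic_on_imp_continuous_on[OF holomorphic_Q_f]]) auto
  have "integral {-pi..pi} G = (LINT t|lborel. indicator {-pi..pi} t *\<^sub>R G t)"
    using set_borel_integral_eq_integral(2)[OF borel_integrable_atLeastAtMost'[OF continuous_G]]
    by (simp add: set_lebesgue_integral_def)
  also have "\<dots> = d\<^sup>2 *\<^sub>R (LINT u|lborel. indicator {-pi..pi} (d\<^sup>2 * u) *\<^sub>R G (d\<^sup>2 * u))"
    using d by (subst lborel_integral_real_affine[where c = "d\<^sup>2" and t = 0]) auto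
  also have "(\<lambda>u. indicator {-pi..pi} (d\<^sup>2 * u) *\<^sub>R G (d\<^sup>2 * u))
      = (\<lambda>u. Q (of_real r) * (circle_kernel d n u * f (rcis r (d\<^sup>2 * u))))"
    using Q_r_nonzero by (simp add: G_def circle_kernel_def r_def[symmetric] scaleR_conv_of_real mult_ac)
  finally have "integral {-pi..pi} G = of_real (d\<^sup>2) * Q (of_real r) * arc_integral UNIV f d n"
    by (simp add: arc_integral_def r_def scaleR_conv_of_real mult.assoc)
  then show ?thesis
    using ps_coeff_eq_circle_integral[OF holomorphic_Q_f r_bounds, of n] r_bounds
    by (simp add: G_def circle_scale_def r_def[symmetric] field_simps)
qed

lemma integrable_arc_integral:
  assumes A: "A \<in> sets borel" and f: "continuous_on (ball 0 1) f" and d: "0 < d"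
  shows "integrable lborel
    (\<lambda>u. indicator A (d\<^sup>2 * u) *\<^sub>R (circle_kernel d n u * f (rcis (exp (- d)) (d\<^sup>2 * u))))"
proof -
  define r where "r = exp (- d)"
  have r_bounds: "0 < r" "r < 1" using d by (auto simp: r_def)
  have Q_r_nonzero: "Q (of_real r) \<noteq> 0" using r_bounds by (intro Q_nonzero) simp
  have continuous_Q: "continuous_on (ball 0 1) Q"
    by (rule holomorphic_on_imp_continuous_on[OF holomorphic_Q])
  have "integrable lborel (\<lambda>u. indicator {- pi / d\<^sup>2..pi / d\<^sup>2} u *\<^sub>R
     (Q (rcis r (d\<^sup>2 * u)) / Q (of_real r) * cis (- (real n * (d\<^sup>2 * u))) * f (rcis r (d\<^sup>2 * u))))"
    using r_bounds Q_r_nonzero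
    by (intro borel_integrable_compact compact_Icc continuous_intros
         continuous_on_compose2[OF f] continuous_on_compose2[OF continuous_Q]) auto
  moreover have "indicator {- pi / d\<^sup>2..pi / d\<^sup>2} u = (indicator {-pi..pi} (d\<^sup>2 * u) :: real)" for u
    using d by (auto simp: field_simps split: split_indicator)
  ultimately have "integrable lborel (\<lambda>u. circle_kernel d n u * f (rcis (exp (- d)) (d\<^sup>2 * u)))"
    by (simp add: circle_kernel_def r_def)
  moreover have "(\<lambda>u. d\<^sup>2 * u) -` A \<in> sets lborel"
    using measurable_sets[of "\<lambda>u. d\<^sup>2 * u" lborel borel A] A by simp
  ultimately have "integrable lborel (\<lambda>u. indicator ((\<lambda>u. d\<^sup>2 * u) -` A) u *\<^sub>R
      (circle_kernel d n u * f (rcis (exp (- d)) (d\<^sup>2 * u))))"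
    by (intro integrable_mult_indicator)
  then show ?thesis
    by (simp add: indicator_vimage)
qed

lemma arc_integral_split:
  assumes A: "A \<in> sets borel" and f: "continuous_on (ball 0 1) f" and d: "0 < d"
  shows "arc_integral UNIV f d n
    = c * arc_integral UNIV (\<lambda>_. 1) d n + arc_integral A (\<lambda>x. f x - c) d n
      + arc_integral (- A) (\<lambda>x. f x - c) d n"
proof -
  have "continuous_on (ball 0 1) (\<lambda>x. f x - c)"
    by (intro continuous_intros f)
  then have parts: "integrable lborel (\<lambda>u. indicator B (d\<^sup>2 * u) *\<^sub>R
      (circle_kernel d n u * (f (rcis (exp (- d)) (d\<^sup>2 * u)) - c)))" if "B \<in> {A, - A}" for B
    using that A d by (intro integrable_arc_integral) (auto intro: borel_comp)
  have kernel: "integrable lborel (circle_kernel d n)"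
    using integrable_arc_integral[of UNIV "\<lambda>_. 1" d n] d by simp
  have "arc_integral UNIV f d n = (LINT u|lborel.
      c * (indicator UNIV (d\<^sup>2 * u) *\<^sub>R (circle_kernel d n u * 1))
      + indicator A (d\<^sup>2 * u) *\<^sub>R (circle_kernel d n u * (f (rcis (exp (- d)) (d\<^sup>2 * u)) - c))
      + indicator (- A) (d\<^sup>2 * u) *\<^sub>R (circle_kernel d n u * (f (rcis (exp (- d)) (d\<^sup>2 * u)) - c)))"
    unfolding arc_integral_def
    by (intro Bochner_Integration.integral_cong) (auto simp: algebra_simps split: split_indicator)
  also have "\<dots> = c * arc_integral UNIV (\<lambda>_. 1) d n + arc_integral A (\<lambda>x. f x - c) d n
      + arc_integral (- A) (\<lambda>x. f x - c) d n"
    unfolding arc_integral_def using parts[of A] parts[of "- A"] kernel by simp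
  finally show ?thesis .
qed

text \<open>The constant is \<open>360 = 72 \<cdot> 5\<close>: on the circle \<open>d\<^sup>2 |u| \<le> \<pi> < 4\<close>, and
  \<open>(|u| - 1) (1 + 4 |u|) \<le> 5 u\<^sup>2\<close>.\<close>
definition kernel_bound :: "real \<Rightarrow> real" where
  "kernel_bound u = exp ((1 - \<bar>u\<bar>) / 360)"

lemma integrable_exp_minus_abs:
  fixes c :: real
  assumes "0 < c"
  shows "integrable lborel (\<lambda>u. exp (- (c * \<bar>u\<bar>)))"
proof -
  have pos_part: "integrable lborel (\<lambda>u. indicator {0<..} u *\<^sub>R exp (- (u * c)))"
    using integrable_I0i_exp_mscale[OF assms] by (simp add: set_integrable_def)
  have neg_part: "integrable lborel (\<lambda>u. indicator {0<..} (0 + -1 * u) *\<^sub>R exp (- ((0 + -1 * u) * c)))"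
    by (rule lborel_integrable_real_affine[OF pos_part]) simp
  show ?thesis
  proof (rule Bochner_Integration.integrable_bound[OF
        Bochner_Integration.integrable_add[OF pos_part neg_part]])
    have "AE u::real in lborel. u \<noteq> 0" by (rule AE_lborel_singleton)
    then show "AE u in lborel. norm (exp (- (c * \<bar>u\<bar>)))
        \<le> norm (indicator {0<..} u *\<^sub>R exp (- (u * c))
            + indicator {0<..} (0 + -1 * u) *\<^sub>R exp (- ((0 + -1 * u) * c)))"
      by eventually_elim (auto simp: abs_if mult.commute split: split_indicator)
  qed auto
qed

lemma integrable_kernel_bound: "integrable lborel kernel_bound"
proof -
  have "integrable lborel (\<lambda>u::real. exp (1/360) * exp (- (1/360 * \<bar>u\<bar>)))"
    by (intro Bochner_Integration.integrable_mult_right integrable_exp_minus_abs) simp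
  also have "(\<lambda>u::real. exp (1/360) * exp (- (1/360 * \<bar>u\<bar>))) = kernel_bound"
    by (simp add: kernel_bound_def fun_eq_iff exp_add[symmetric] diff_divide_distrib)
  finally show ?thesis .
qed

lemma circle_decay_scaled_ge:
  assumes d: "0 < d" and u: "\<bar>d\<^sup>2 * u\<bar> \<le> pi"
  shows "(\<bar>u\<bar> - 1) / 360 \<le> circle_decay d (d\<^sup>2 * u)"
proof -
  have "72 * d\<^sup>2 * (d\<^sup>2 + (d\<^sup>2 * u)\<^sup>2) = d ^ 4 * (72 * (1 + (d\<^sup>2 * \<bar>u\<bar>) * \<bar>u\<bar>))"
    by (simp add: algebra_simps power2_eq_square numeral_eq_Suc abs_mult_self_eq)
  moreover have "(d\<^sup>2 * u)\<^sup>2 = d ^ 4 * u\<^sup>2"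
    by (simp add: power_mult_distrib)
  ultimately have decay_eq: "circle_decay d (d\<^sup>2 * u) = u\<^sup>2 / (72 * (1 + (d\<^sup>2 * \<bar>u\<bar>) * \<bar>u\<bar>))"
    using d by (simp add: circle_decay_def)
  have "d\<^sup>2 * \<bar>u\<bar> \<le> 4" using u pi_less_4 by (simp add: abs_mult)
  then have denominator_le: "1 + (d\<^sup>2 * \<bar>u\<bar>) * \<bar>u\<bar> \<le> 1 + 4 * \<bar>u\<bar>"
    by (intro add_left_mono mult_right_mono) auto
  have "(\<bar>u\<bar> - 1) * (1 + 4 * \<bar>u\<bar>) = 4 * u\<^sup>2 - 3 * \<bar>u\<bar> - 1"
    unfolding power2_abs[of u, symmetric]
    by (simp add: algebra_simps power2_eq_square del: abs_mult_self_eq)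
  also have "\<dots> \<le> 5 * u\<^sup>2"
    using zero_le_power2[of u] abs_ge_zero[of u] by linarith
  finally have "(\<bar>u\<bar> - 1) / 360 * (72 * (1 + 4 * \<bar>u\<bar>)) \<le> u\<^sup>2"
    by (simp add: field_simps)
  then have "(\<bar>u\<bar> - 1) / 360 \<le> u\<^sup>2 / (72 * (1 + 4 * \<bar>u\<bar>))"
    by (subst pos_le_divide_eq) (simp_all add: add_pos_nonneg)
  also have "\<dots> \<le> circle_decay d (d\<^sup>2 * u)"
    unfolding decay_eq using denominator_le
    by (intro divide_left_mono mult_left_mono mult_pos_pos) (auto intro!: add_pos_nonneg)
  finally show ?thesis .
qed

lemma norm_circle_kernel_le_decay:
  assumes d: "0 < d" "d \<le> 1"
  shows "norm (circle_kernel d n u) \<le> indicator {-pi..pi} (d\<^sup>2 * u) * exp (- circle_decay d (d\<^sup>2 * u))"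
  using norm_Q_ratio_le[OF d, of "d\<^sup>2 * u"]
  by (auto simp: circle_kernel_def norm_mult norm_divide abs_le_iff split: split_indicator)

lemma norm_circle_kernel_le:
  assumes d: "0 < d" "d \<le> 1"
  shows "norm (circle_kernel d n u) \<le> kernel_bound u"
proof (cases "\<bar>d\<^sup>2 * u\<bar> \<le> pi")
  case True
  have "norm (circle_kernel d n u) \<le> exp (- circle_decay d (d\<^sup>2 * u))"
    by (rule order_trans[OF norm_circle_kernel_le_decay[OF d]]) (simp split: split_indicator)
  also have "\<dots> \<le> kernel_bound u"
    using circle_decay_scaled_ge[OF d(1) True] by (simp add: kernel_bound_def diff_divide_distrib)
  finally show ?thesis .
next
  case False
  then have "circle_kernel d n u = 0"
    by (auto simp: circle_kernel_def split: split_indicator)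
  then show ?thesis by (simp add: kernel_bound_def)
qed

lemma norm_arc_integral_le_dominated:
  assumes g: "integrable lborel g" "\<And>u. 0 \<le> g u"
    and kernel: "\<And>u. d\<^sup>2 * u \<in> A \<Longrightarrow> norm (circle_kernel d n u) \<le> g u"
    and f: "\<And>\<theta>. \<theta> \<in> A \<Longrightarrow> norm (f (rcis (exp (- d)) \<theta>)) \<le> M" and M: "0 \<le> M"
  shows "norm (arc_integral A f d n) \<le> M * integral\<^sup>L lborel g"
proof -
  have "norm (arc_integral A f d n) \<le> (LINT u|lborel. norm (indicator A (d\<^sup>2 * u) *\<^sub>R
      (circle_kernel d n u * f (rcis (exp (- d)) (d\<^sup>2 * u)))))"
    unfolding arc_integral_def by (rule integral_norm_bound)
  also have "\<dots> \<le> (LINT u|lborel. g u * M)"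
    using g M
    by (intro integral_mono') (auto simp: norm_mult intro!: mult_mono kernel f split: split_indicator)
  finally show ?thesis by (simp add: mult.commute)
qed

lemma norm_arc_integral_le:
  assumes d: "0 < d" "d \<le> 1" and M: "0 \<le> M"
    and f: "\<And>\<theta>. \<theta> \<in> A \<Longrightarrow> norm (f (rcis (exp (- d)) \<theta>)) \<le> M"
  shows "norm (arc_integral A f d n) \<le> M * integral\<^sup>L lborel kernel_bound"
proof (rule norm_arc_integral_le_dominated[OF integrable_kernel_bound])
  show "0 \<le> kernel_bound u" for u by (simp add: kernel_bound_def)
qed (use norm_circle_kernel_le[OF d] f M in auto)

lemma norm_arc_integral_le_decay:
  assumes d: "0 < d" "d \<le> 1" and M: "0 \<le> M"
    and f: "\<And>\<theta>. \<theta> \<in> A \<Longrightarrow> norm (f (rcis (exp (- d)) \<theta>)) \<le> M" and A: "\<And>\<theta>. \<theta> \<in> A \<Longrightarrow> \<bar>\<delta>\<bar> \<le> \<bar>\<theta>\<bar>"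
  shows "norm (arc_integral A f d n) \<le> M * (exp (- circle_decay d \<delta>) * (2 * pi / d\<^sup>2))"
proof -
  define g :: "real \<Rightarrow> real" where
    "g = (\<lambda>u. indicator {- (pi / d\<^sup>2)..pi / d\<^sup>2} u *\<^sub>R exp (- circle_decay d \<delta>))"
  have "norm (arc_integral A f d n) \<le> M * integral\<^sup>L lborel g"
  proof (rule norm_arc_integral_le_dominated)
    show "integrable lborel g"
      unfolding g_def by (intro borel_integrable_compact compact_Icc continuous_intros)
    fix u assume "d\<^sup>2 * u \<in> A"
    then have "exp (- circle_decay d (d\<^sup>2 * u)) \<le> exp (- circle_decay d \<delta>)"
      using circle_decay_mono[OF d(1) A] by simp
    moreover have "d\<^sup>2 * u \<in> {-pi..pi} \<longleftrightarrow> u \<in> {- (pi / d\<^sup>2)..pi / d\<^sup>2}"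
      using d by (auto simp: field_simps)
    ultimately show "norm (circle_kernel d n u) \<le> g u"
      using norm_circle_kernel_le_decay[OF d, of n u]
      by (auto simp: g_def split: split_indicator_asm elim: order_trans)
  qed (simp_all add: g_def f M)
  also have "integral\<^sup>L lborel g = exp (- circle_decay d \<delta>) * (2 * pi / d\<^sup>2)"
    by (simp add: g_def)
  finally show ?thesis .
qed

lemma integral_gaussian:
  fixes c :: real
  assumes "0 < c"
  shows "(LINT u|lborel. exp (- (c * u\<^sup>2))) = sqrt (pi / c)"
proof -
  define s where "s = sqrt (1 / (2 * c))"
  have s_pos_square: "0 < s" "s\<^sup>2 = 1 / (2 * c)" using assms by (auto simp: s_def)
  have "exp (- (c * u\<^sup>2)) = sqrt (pi / c) * normal_density 0 s u" for u
    using assms by (simp add: normal_density_def s_pos_square real_sqrt_divide field_simps)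
  then have "(LINT u|lborel. exp (- (c * u\<^sup>2))) = sqrt (pi / c) * (LINT u|lborel. normal_density 0 s u)"
    by simp
  then show ?thesis using s_pos_square by simp
qed

lemma circle_kernel_tendsto:
  assumes d: "filterlim d (at_right 0) F"
    and saddle: "((\<lambda>n. 2 * zeta 3 / d n - real (m n) * d n ^ 2) \<longlongrightarrow> 0) F"
  shows "((\<lambda>n. circle_kernel (d n) (m n) u) \<longlongrightarrow> of_real (exp (- (3 * zeta 3 * u\<^sup>2)))) F"
proof (rule Lim_transform_eventually[OF Q_ratio_tendsto[OF d saddle, of u]])
  have "((\<lambda>n. d n ^ 2 * u) \<longlongrightarrow> 0 ^ 2 * u) F"
    using d by (intro tendsto_intros) (simp add: filterlim_at)
  then have "\<forall>\<^sub>F n in F. \<bar>d n ^ 2 * u\<bar> < pi"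
    by (intro order_tendstoD(2)[OF tendsto_rabs]) auto
  then show "\<forall>\<^sub>F n in F. Q (rcis (exp (- d n)) (d n ^ 2 * u)) / Q (of_real (exp (- d n)))
      * cis (- (real (m n) * (d n ^ 2 * u))) = circle_kernel (d n) (m n) u"
    by eventually_elim (auto simp: circle_kernel_def split: split_indicator)
qed

lemma eventually_at_right_0_unit:
  assumes "filterlim d (at_right 0) F"
  shows "\<forall>\<^sub>F n in F. 0 < d n \<and> d n \<le> (1::real)"
proof -
  have "\<forall>\<^sub>F x in at_right 0. 0 < x \<and> x \<le> (1::real)"
    by (auto simp: eventually_at_right_field intro: exI[of _ 1])
  then show ?thesis
    by (rule eventually_compose_filterlim[OF _ assms])
qed

lemma arc_integral_tendsto:
  fixes d :: "nat \<Rightarrow> real"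
  assumes d: "filterlim d (at_right 0) sequentially"
    and saddle: "(\<lambda>n. 2 * zeta 3 / d n - real n * d n ^ 2) \<longlonglongrightarrow> 0"
  shows "(\<lambda>n. arc_integral UNIV (\<lambda>_. 1) (d n) n) \<longlonglongrightarrow> of_real (sqrt (pi / (3 * zeta 3)))"
proof -
  note small = eventually_at_right_0_unit[OF d]
  define k where "k = (\<lambda>n u. if 0 < d n \<and> d n \<le> 1 then circle_kernel (d n) n u else 0)"
  have "(\<lambda>n. LINT u|lborel. k n u) \<longlonglongrightarrow> (LINT u|lborel. complex_of_real (exp (- (3 * zeta 3 * u\<^sup>2))))"
  proof (rule integral_dominated_convergence[OF _ _ integrable_kernel_bound])
    have "circle_kernel (d n) n \<in> borel_measurable lborel" if "0 < d n" for n
      using integrable_arc_integral[of UNIV "\<lambda>_. 1" "d n" n] that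
      by (simp add: borel_measurable_integrable)
    then show "k n \<in> borel_measurable lborel" for n
      by (cases "0 < d n \<and> d n \<le> 1"; simp only: k_def if_True if_False; simp)
    show "AE u in lborel. norm (k n u) \<le> kernel_bound u" for n
      using norm_circle_kernel_le[of "d n" n] by (auto simp: k_def kernel_bound_def)
    have "(\<lambda>n. k n u) \<longlonglongrightarrow> complex_of_real (exp (- (3 * zeta 3 * u\<^sup>2)))" for u
      by (rule Lim_transform_eventually[OF circle_kernel_tendsto[OF d saddle]])
         (use small in \<open>eventually_elim, simp add: k_def\<close>)
    then show "AE u in lborel. (\<lambda>n. k n u) \<longlonglongrightarrow> complex_of_real (exp (- (3 * zeta 3 * u\<^sup>2)))"
      by simp
  qed measurable
  also have "(LINT u|lborel. complex_of_real (exp (- (3 * zeta 3 * u\<^sup>2))))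
      = of_real (sqrt (pi / (3 * zeta 3)))"
    unfolding integral_complex_of_real using integral_gaussian[of "3 * zeta 3"] zeta_pos[of 3] by simp
  finally show ?thesis
    by (rule Lim_transform_eventually)
       (use small in \<open>eventually_elim, simp add: k_def arc_integral_def\<close>)
qed

subsection \<open>Sequences of saddle points\<close>

text \<open>To leading order, \<open>n - 2 \<zeta>(3) / d\<^sup>3\<close> is the derivative of \<open>log Q(e\<^sup>-\<^sup>d) + n d\<close>.\<close>
locale saddle_sequence =
  fixes d :: "nat \<Rightarrow> real"
  assumes at_right_0: "filterlim d (at_right 0) sequentially"
    and saddle: "(\<lambda>n. 2 * zeta 3 / d n - real n * d n ^ 2) \<longlonglongrightarrow> 0"

lemma leading_error_smallo:
  fixes d :: "nat \<Rightarrow> real" and \<beta> :: real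
  assumes \<beta>: "\<beta> > 0"
    and d: "(\<lambda>n. d n - ((2 * zeta 3 / real n) powr (1/3) - 1 / (36 * real n)))
              \<in> O(\<lambda>n. real n powr (- 1 - \<beta>))"
  shows "(\<lambda>n. d n - (2 * zeta 3 / real n) powr (1/3)) \<in> o(\<lambda>n. real n powr (-2/3))"
proof -
  have "(\<lambda>n. real n powr (- 1 - \<beta>)) \<in> o(\<lambda>n. real n powr (-2/3))"
    using \<beta> by real_asymp
  with d have "(\<lambda>n. d n - ((2 * zeta 3 / real n) powr (1/3) - 1 / (36 * real n)))
      \<in> o(\<lambda>n. real n powr (-2/3))"
    by (rule landau_o.big_small_trans)
  moreover have "(\<lambda>n. 1 / (36 * real n)) \<in> o(\<lambda>n. real n powr (-2/3))"
    by real_asymp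
  ultimately have "(\<lambda>n. (d n - ((2 * zeta 3 / real n) powr (1/3) - 1 / (36 * real n)))
      - 1 / (36 * real n)) \<in> o(\<lambda>n. real n powr (-2/3))"
    by (rule sum_in_smallo)
  then show ?thesis by simp
qed

lemma scaled_saddle_error_tendsto:
  fixes d :: "nat \<Rightarrow> real"
  assumes d: "(\<lambda>n. d n - (2 * zeta 3 / real n) powr (1/3)) \<in> o(\<lambda>n. real n powr (-2/3))"
  shows "(\<lambda>n. real n powr (1/3) * (real n powr (1/3) * d n - (2 * zeta 3) powr (1/3))) \<longlonglongrightarrow> 0"
proof -
  have "(\<lambda>n. (d n - (2 * zeta 3 / real n) powr (1/3)) / real n powr (-2/3)) \<longlonglongrightarrow> 0"
    by (rule smalloD_tendsto[OF d])
  moreover have "\<forall>\<^sub>F n in sequentially.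
      (d n - (2 * zeta 3 / real n) powr (1/3)) / real n powr (-2/3)
        = real n powr (1/3) * (real n powr (1/3) * d n - (2 * zeta 3) powr (1/3))"
    using eventually_gt_at_top[of 0]
  proof eventually_elim
    case (elim n)
    have "real n powr (-2/3) = inverse (real n powr (1/3) * real n powr (1/3))"
      by (simp add: powr_minus powr_add[symmetric])
    then show ?case
      using elim zeta_pos[of 3] by (simp add: powr_divide field_simps)
  qed
  ultimately show ?thesis
    by (rule Lim_transform_eventually)
qed

lemma tendsto_of_scaled_tendsto_0:
  fixes y t :: "'a \<Rightarrow> 'b :: real_normed_field"
  assumes "filterlim t at_infinity F" and "((\<lambda>n. t n * (y n - a)) \<longlongrightarrow> 0) F"
  shows "(y \<longlongrightarrow> a) F"
proof -
  have "((\<lambda>n. t n * (y n - a) / t n + a) \<longlongrightarrow> 0 + a) F"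
    by (intro tendsto_add tendsto_divide_0[OF assms(2,1)] tendsto_const)
  moreover have "\<forall>\<^sub>F n in F. t n * (y n - a) / t n + a = y n"
    using filterlim_at_infinity_imp_eventually_ne[OF assms(1), of 0] by eventually_elim simp
  ultimately show ?thesis
    using Lim_transform_eventually by fastforce
qed

lemma scaled_cube_defect_tendsto:
  fixes y t :: "'a \<Rightarrow> 'b :: real_normed_field"
  assumes scaled: "((\<lambda>n. t n * (y n - a)) \<longlongrightarrow> 0) F" and y: "(y \<longlongrightarrow> a) F" and a: "a \<noteq> 0"
  shows "((\<lambda>n. t n * (a ^ 3 / y n - y n ^ 2)) \<longlongrightarrow> 0) F"
proof -
  have "((\<lambda>n. - (t n * (y n - a)) * (y n ^ 2 + y n * a + a ^ 2) / y n)
      \<longlongrightarrow> - 0 * (a ^ 2 + a * a + a ^ 2) / a) F"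
    by (intro tendsto_intros scaled y a)
  moreover have "\<forall>\<^sub>F n in F. - (t n * (y n - a)) * (y n ^ 2 + y n * a + a ^ 2) / y n
      = t n * (a ^ 3 / y n - y n ^ 2)"
    using tendsto_imp_eventually_ne[OF y a]
    by eventually_elim (simp add: field_simps power2_eq_square power3_eq_cube)
  ultimately show ?thesis
    using Lim_transform_eventually by fastforce
qed

lemma saddle_sequenceI:
  fixes d :: "nat \<Rightarrow> real"
  assumes "(\<lambda>n. d n - (2 * zeta 3 / real n) powr (1/3)) \<in> o(\<lambda>n. real n powr (-2/3))"
  shows "saddle_sequence d"
proof
  define a where "a = (2 * zeta 3) powr (1/3)"
  have a_pos_cube: "0 < a" "a ^ 3 = 2 * zeta 3"
    using zeta_pos[of 3] by (auto simp: a_def powr_power)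
  define t where "t = (\<lambda>n. real n powr (1/3))"
  have t_pos: "\<forall>\<^sub>F n in sequentially. 0 < t n"
    using eventually_gt_at_top[of 0] by eventually_elim (simp add: t_def)
  have t_cube: "real n = t n ^ 3" for n
    by (cases "n = 0") (simp_all add: t_def powr_power)
  have t_at_infinity: "filterlim t at_infinity sequentially"
    unfolding t_def by real_asymp
  define y where "y = (\<lambda>n. t n * d n)"
  have scaled_error_tendsto: "(\<lambda>n. t n * (y n - a)) \<longlonglongrightarrow> 0"
    using scaled_saddle_error_tendsto[OF assms] by (simp add: y_def t_def a_def)
  then have y_tendsto: "y \<longlonglongrightarrow> a"
    by (rule tendsto_of_scaled_tendsto_0[OF t_at_infinity])
  have "d \<longlonglongrightarrow> 0"
    by (rule Lim_transform_eventually[OF tendsto_divide_0[OF y_tendsto t_at_infinity]])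
       (use t_pos in \<open>eventually_elim, simp add: y_def\<close>)
  moreover have "\<forall>\<^sub>F n in sequentially. 0 < d n"
    using order_tendstoD(1)[OF y_tendsto a_pos_cube(1)] t_pos
    by eventually_elim (simp add: y_def zero_less_mult_iff)
  ultimately show "filterlim d (at_right 0) sequentially"
    by (auto simp: filterlim_at elim: eventually_mono)
  have "(\<lambda>n. t n * (a ^ 3 / y n - y n ^ 2)) \<longlonglongrightarrow> 0"
    using a_pos_cube(1) by (intro scaled_cube_defect_tendsto scaled_error_tendsto y_tendsto) simp
  then show "(\<lambda>n. 2 * zeta 3 / d n - real n * d n ^ 2) \<longlonglongrightarrow> 0"
  proof (rule Lim_transform_eventually)
    show "\<forall>\<^sub>F n in sequentially. t n * (a ^ 3 / y n - y n ^ 2) = 2 * zeta 3 / d n - real n * d n ^ 2"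
      unfolding t_cube a_pos_cube(2)[symmetric] y_def using t_pos
      by eventually_elim (simp add: field_simps power2_eq_square power3_eq_cube)
  qed
qed

subsection \<open>The contributions of the near and the far arc\<close>

lemma one_minus_exp_minus_ge:
  fixes d :: real
  assumes "0 < d" "d \<le> 1"
  shows "d / 3 \<le> 1 - exp (- d)"
proof -
  have "d \<le> exp d - 1"
    using exp_ge_add_one_self[of d] by linarith
  then have "1 / 3 * d \<le> exp (- d) * (exp d - 1)"
    using exp_minus_ge_third[OF assms(2)] assms by (intro mult_mono) auto
  then show ?thesis by (simp add: algebra_simps exp_minus)
qed

lemma circle_decay_ge_powr:
  fixes d l :: real
  assumes d: "0 < d" "d \<le> 1" and l: "1 \<le> l"
  shows "d powr (-2/3) / (144 * l\<^sup>2) \<le> circle_decay d (d powr (5/3) / l)"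
proof -
  define \<delta> where "\<delta> = d powr (5/3) / l"
  have "d powr (5/3) / l \<le> d powr (5/3) / 1"
    using l by (intro divide_left_mono) auto
  also have "\<dots> \<le> d powr 1"
    using d powr_mono'[of 1 "5/3" d] by simp
  finally have "\<delta> \<le> d" using d by (simp add: \<delta>_def)
  moreover have "0 < \<delta>" using d l by (simp add: \<delta>_def)
  ultimately have "\<delta>\<^sup>2 \<le> d\<^sup>2" by (intro power_mono) auto
  then have "\<delta>\<^sup>2 / (72 * d\<^sup>2 * (d\<^sup>2 + d\<^sup>2)) \<le> circle_decay d \<delta>"
    unfolding circle_decay_def using d
    by (intro divide_left_mono mult_left_mono add_left_mono mult_pos_pos add_pos_nonneg) auto
  moreover have "\<delta>\<^sup>2 / (72 * d\<^sup>2 * (d\<^sup>2 + d\<^sup>2)) = d powr (-2/3) / (144 * l\<^sup>2)"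
  proof -
    have "(d powr (5/3))\<^sup>2 = d powr (10/3)" using d by (simp add: powr_power)
    also have "\<dots> = d powr (-2/3) * d powr 4" by (simp add: powr_add[symmetric])
    also have "d powr 4 = d ^ 4" using d by simp
    finally have "\<delta>\<^sup>2 = d powr (-2/3) * d ^ 4 / l\<^sup>2"
      by (simp add: \<delta>_def power_divide)
    moreover have "72 * d\<^sup>2 * (d\<^sup>2 + d\<^sup>2) = 144 * d ^ 4" by (simp add: numeral_eq_Suc)
    ultimately show ?thesis using d by simp
  qed
  ultimately show ?thesis by (simp add: \<delta>_def)
qed

definition tail_rate :: "nat \<Rightarrow> real" where
  "tail_rate n = real n powr (2/9) / (ln (real n))\<^sup>2"

lemma tail_rate_nonneg: "0 \<le> tail_rate n"
  by (simp add: tail_rate_def)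

context saddle_sequence
begin

abbreviation z :: "nat \<Rightarrow> complex" where
  "z n \<equiv> of_real (exp (- d n))"

definition arc_width :: "nat \<Rightarrow> real" where
  "arc_width n = d n powr (5/3) / ln (real n)"

abbreviation near_arc :: "nat \<Rightarrow> real set" where
  "near_arc n \<equiv> {- arc_width n..arc_width n}"

definition kernel_mass :: "nat \<Rightarrow> complex" where
  "kernel_mass n = arc_integral UNIV (\<lambda>_. 1) (d n) n"

definition near_error :: "(complex \<Rightarrow> complex) \<Rightarrow> nat \<Rightarrow> complex" where
  "near_error F n = arc_integral (near_arc n) (\<lambda>x. F x - F (z n)) (d n) n / kernel_mass n"

definition far_error :: "(complex \<Rightarrow> complex) \<Rightarrow> nat \<Rightarrow> complex" where
  "far_error F n = arc_integral (- near_arc n) (\<lambda>x. F x - F (z n)) (d n) n / kernel_mass n"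

lemma eventually_d: "\<forall>\<^sub>F n in sequentially. 0 < d n \<and> d n \<le> 1"
  by (rule eventually_at_right_0_unit[OF at_right_0])

lemma cube_tendsto: "(\<lambda>n. real n * d n ^ 3) \<longlonglongrightarrow> 2 * zeta 3"
proof -
  have "d \<longlonglongrightarrow> 0"
    using at_right_0 by (simp add: filterlim_at)
  then have "(\<lambda>n. 2 * zeta 3 - (2 * zeta 3 / d n - real n * d n ^ 2) * d n) \<longlonglongrightarrow> 2 * zeta 3 - 0 * 0"
    by (intro tendsto_intros saddle)
  then have "(\<lambda>n. real n * d n ^ 3) \<longlonglongrightarrow> 2 * zeta 3 - 0 * 0"
    by (rule Lim_transform_eventually)
       (use eventually_d in \<open>eventually_elim, simp add: field_simps power2_eq_square power3_eq_cube\<close>)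
  then show ?thesis by simp
qed

lemma powr_bigtheta: "(\<lambda>n. d n powr p) \<in> \<Theta>(\<lambda>n. real n powr (- p / 3))"
proof (rule bigthetaI_tendsto)
  show "(2 * zeta 3) powr (p / 3) \<noteq> 0"
    using zeta_pos[of 3] by simp
  have "(\<lambda>n. (real n * d n ^ 3) powr (p / 3)) \<longlonglongrightarrow> (2 * zeta 3) powr (p / 3)"
    using zeta_pos[of 3] by (intro tendsto_powr cube_tendsto tendsto_const) simp
  then show "(\<lambda>n. d n powr p / real n powr (- p / 3)) \<longlonglongrightarrow> (2 * zeta 3) powr (p / 3)"
  proof (rule Lim_transform_eventually)
    show "\<forall>\<^sub>F n in sequentially. (real n * d n ^ 3) powr (p / 3) = d n powr p / real n powr (- p / 3)"
      using eventually_d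
    proof eventually_elim
      case (elim n)
      then have "(d n ^ 3) powr (p / 3) = d n powr p"
        by (simp add: powr_powr flip: powr_numeral)
      then show ?case
        using elim by (simp add: powr_mult powr_minus field_simps)
    qed
  qed
qed

lemma powr_minus_2_bigo: "(\<lambda>n. d n powr (-2)) \<in> O(\<lambda>n. real n)"
proof -
  have "(\<lambda>n. d n powr (-2)) \<in> O(\<lambda>n. real n powr (2/3))"
    using bigthetaD1[OF powr_bigtheta[of "-2"]] by simp
  also have "(\<lambda>n. real n powr (2/3)) \<in> O(\<lambda>n. real n)"
    by real_asymp
  finally show ?thesis .
qed

lemma kernel_mass_tendsto: "kernel_mass \<longlonglongrightarrow> of_real (sqrt (pi / (3 * zeta 3)))"
  unfolding kernel_mass_def[abs_def] by (rule arc_integral_tendsto[OF at_right_0 saddle])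

lemma kernel_mass_limit_nonzero: "complex_of_real (sqrt (pi / (3 * zeta 3))) \<noteq> 0"
  using zeta_pos[of 3] by simp

lemma coefficient_ratio:
  assumes F: "F holomorphic_on ball 0 1"
  shows "\<forall>\<^sub>F n in sequentially.
    1 / q n * ps_coeff n (\<lambda>x. Q x * F x) = F (z n) + near_error F n + far_error F n"
  using eventually_d tendsto_imp_eventually_ne[OF kernel_mass_tendsto kernel_mass_limit_nonzero]
proof eventually_elim
  case (elim n)
  have "q n = circle_scale (d n) n * kernel_mass n"
    using ps_coeff_Q_mult[of "\<lambda>_. 1" "d n" n] elim by (simp add: q_def kernel_mass_def)
  moreover have "arc_integral UNIV F (d n) n = (F (z n) + near_error F n + far_error F n) * kernel_mass n"
    using elim
      arc_integral_split[OF atLeastAtMost_borel holomorphic_on_imp_continuous_on[OF F], of "d n" n "F (z n)"]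
    by (simp add: near_error_def far_error_def kernel_mass_def[symmetric] field_simps)
  ultimately show ?case
    using ps_coeff_Q_mult[OF F, of "d n" n] elim circle_scale_nonzero[of "d n" n] by simp
qed

context
  fixes F :: "complex \<Rightarrow> complex"
  assumes flat: "\<And>\<epsilon>. \<epsilon> > 0 \<Longrightarrow> \<forall>\<^sub>F n in sequentially. \<forall>\<theta>. \<bar>\<theta>\<bar> \<le> arc_width n \<longrightarrow>
    norm (F (rcis (exp (- d n)) \<theta>) / F (z n) - 1) < \<epsilon>"
begin

lemma eventually_nonzero_of_flat: "\<forall>\<^sub>F n in sequentially. F (z n) \<noteq> 0"
  using flat[OF zero_less_one] eventually_gt_at_top[of 0]
proof eventually_elim
  case (elim n)
  then have "\<bar>0\<bar> \<le> arc_width n" by (simp add: arc_width_def)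
  with elim have "norm (F (z n) / F (z n) - 1) < 1"
    by (metis rcis_zero_arg)
  then show ?case by auto
qed

lemma near_arc_integral_smallo:
  "(\<lambda>n. arc_integral (near_arc n) (\<lambda>x. F x - F (z n)) (d n) n) \<in> o(\<lambda>n. F (z n))"
proof (rule landau_o.smallI)
  fix c :: real assume c_pos: "0 < c"
  define W where "W = integral\<^sup>L lborel kernel_bound"
  have W_nonneg: "0 \<le> W"
    unfolding W_def by (intro integral_nonneg_AE) (auto simp: kernel_bound_def)
  define \<epsilon> where "\<epsilon> = c / (W + 1)"
  have \<epsilon>_bounds: "0 < \<epsilon>" "\<epsilon> * W \<le> c"
    using c_pos W_nonneg by (auto simp: \<epsilon>_def field_simps)
  show "\<forall>\<^sub>F n in sequentially. norm (arc_integral (near_arc n) (\<lambda>x. F x - F (z n)) (d n) n)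
      \<le> c * norm (F (z n))"
    using flat[OF \<epsilon>_bounds(1)] eventually_nonzero_of_flat eventually_d
  proof eventually_elim
    case (elim n)
    have "norm (F (rcis (exp (- d n)) \<theta>) - F (z n)) \<le> \<epsilon> * norm (F (z n))"
      if "\<theta> \<in> near_arc n" for \<theta>
    proof -
      have "F (rcis (exp (- d n)) \<theta>) - F (z n) = (F (rcis (exp (- d n)) \<theta>) / F (z n) - 1) * F (z n)"
        using elim by (simp add: field_simps)
      then show ?thesis
        using elim that by (auto simp: norm_mult abs_le_iff intro!: mult_right_mono less_imp_le)
    qed
    then have "norm (arc_integral (near_arc n) (\<lambda>x. F x - F (z n)) (d n) n)
        \<le> \<epsilon> * norm (F (z n)) * W"
      unfolding W_def using elim \<epsilon>_bounds by (intro norm_arc_integral_le) auto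
    also have "\<dots> \<le> c * norm (F (z n))"
      using mult_right_mono[OF \<epsilon>_bounds(2), of "norm (F (z n))"] by (simp add: mult_ac)
    finally show ?case .
  qed
qed

lemma near_error_smallo: "(\<lambda>n. near_error F n / F (z n)) \<in> o(\<lambda>n. 1)"
proof (rule smalloI_tendsto)
  have "(\<lambda>n. arc_integral (near_arc n) (\<lambda>x. F x - F (z n)) (d n) n / F (z n) / kernel_mass n)
      \<longlonglongrightarrow> 0 / of_real (sqrt (pi / (3 * zeta 3)))"
    using eventually_nonzero_of_flat
    by (intro tendsto_divide smalloD_tendsto near_arc_integral_smallo
        kernel_mass_tendsto kernel_mass_limit_nonzero)
  then show "(\<lambda>n. near_error F n / F (z n) / 1) \<longlonglongrightarrow> 0"
    by (simp add: near_error_def mult.commute)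
qed simp

end

lemma eventually_norm_le_on_circles:
  fixes F :: "complex \<Rightarrow> complex" and g :: "real \<Rightarrow> real"
  assumes "F \<in> O[filtercomap norm (at_left 1)](\<lambda>x. of_real (g (norm x)))"
  obtains K where "K > 0"
    "\<forall>\<^sub>F n in sequentially. \<forall>\<theta>. norm (F (rcis (exp (- d n)) \<theta>)) \<le> K * \<bar>g (exp (- d n))\<bar>"
proof -
  obtain K where F_bigo_bound: "K > 0"
    "\<forall>\<^sub>F x in filtercomap norm (at_left 1). norm (F x) \<le> K * \<bar>g (norm x)\<bar>"
    using landau_o.bigE[OF assms] by auto
  then obtain R where F_le_near_1: "eventually R (at_left 1)"
    "\<And>x. R (norm x) \<Longrightarrow> norm (F x) \<le> K * \<bar>g (norm x)\<bar>"
    unfolding eventually_filtercomap by auto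
  have "filterlim (\<lambda>x::real. exp (- x)) (at_left 1) (at_right 0)"
    by real_asymp
  from eventually_compose_filterlim[OF F_le_near_1(1) filterlim_compose[OF this at_right_0]]
  have "\<forall>\<^sub>F n in sequentially. \<forall>\<theta>. norm (F (rcis (exp (- d n)) \<theta>)) \<le> K * \<bar>g (exp (- d n))\<bar>"
  proof eventually_elim
    case (elim n)
    then show ?case using F_le_near_1(2)[of "rcis (exp (- d n)) _"] by simp
  qed
  with F_bigo_bound(1) show ?thesis by (rule that)
qed

lemma growth_smallo_tail_rate:
  fixes C \<eta> :: real
  assumes \<eta>: "0 < \<eta>" "\<eta> < 2/3"
  shows "(\<lambda>n. C / (1 - exp (- d n)) powr \<eta> + ln (real n)) \<in> o(tail_rate)"
proof (rule sum_in_smallo)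
  have "(\<lambda>n. C / (1 - exp (- d n)) powr \<eta>) \<in> O(\<lambda>n. d n powr (- \<eta>))"
  proof (rule bigoI)
    show "\<forall>\<^sub>F n in sequentially.
        norm (C / (1 - exp (- d n)) powr \<eta>) \<le> \<bar>C\<bar> * 3 powr \<eta> * norm (d n powr (- \<eta>))"
      using eventually_d
    proof eventually_elim
      case (elim n)
      then have "(1 - exp (- d n)) powr (- \<eta>) \<le> (d n / 3) powr (- \<eta>)"
        using \<eta> one_minus_exp_minus_ge[of "d n"] by (intro powr_mono2') auto
      then have "\<bar>C\<bar> * (1 - exp (- d n)) powr (- \<eta>) \<le> \<bar>C\<bar> * (d n / 3) powr (- \<eta>)"
        by (rule mult_left_mono) simp
      then show ?case
        using elim by (simp add: powr_divide powr_minus field_simps)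
    qed
  qed
  also have "(\<lambda>n. d n powr (- \<eta>)) \<in> \<Theta>(\<lambda>n. real n powr (\<eta> / 3))"
    using powr_bigtheta[of "- \<eta>"] by simp
  also have "(\<lambda>n. real n powr (\<eta> / 3)) \<in> o(tail_rate)"
  proof -
    define \<gamma> where "\<gamma> = 2/9 - \<eta> / 3"
    have "0 < \<gamma>" using \<eta> by (simp add: \<gamma>_def)
    then have "(\<lambda>n. real n powr (2/9 - \<gamma>)) \<in> o(tail_rate)"
      unfolding tail_rate_def[abs_def] by real_asymp
    then show ?thesis by (simp add: \<gamma>_def)
  qed
  finally show "(\<lambda>n. C / (1 - exp (- d n)) powr \<eta>) \<in> o(tail_rate)" .
  show "(\<lambda>n. ln (real n)) \<in> o(tail_rate)"
    unfolding tail_rate_def[abs_def] by real_asymp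
qed

lemma circle_decay_ge_tail_rate:
  obtains c where "c > 0" "\<forall>\<^sub>F n in sequentially. c * tail_rate n \<le> circle_decay (d n) (arc_width n)"
proof -
  have "(\<lambda>n. real n powr (2/9)) \<in> O(\<lambda>n. d n powr (-2/3))"
    using bigthetaD2[OF powr_bigtheta[of "-2/3"]] by (simp add: bigomega_iff_bigo)
  then obtain b where powr_le: "b > 0"
    "\<forall>\<^sub>F n in sequentially. norm (real n powr (2/9)) \<le> b * norm (d n powr (-2/3))"
    by (rule landau_o.bigE)
  have "\<forall>\<^sub>F n in sequentially. 1 \<le> ln (real n)"
    by real_asymp
  with powr_le(2) eventually_d
  have "\<forall>\<^sub>F n in sequentially. 1 / (144 * b) * tail_rate n \<le> circle_decay (d n) (arc_width n)"
  proof eventually_elim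
    case (elim n)
    have "1 / (144 * b) * tail_rate n = real n powr (2/9) / b / (144 * (ln (real n))\<^sup>2)"
      by (simp add: tail_rate_def)
    also have "\<dots> \<le> d n powr (-2/3) / (144 * (ln (real n))\<^sup>2)"
      using elim powr_le(1) by (intro divide_right_mono) (simp_all add: divide_le_eq mult.commute)
    also have "\<dots> \<le> circle_decay (d n) (arc_width n)"
      unfolding arc_width_def using elim by (intro circle_decay_ge_powr) auto
    finally show ?case .
  qed
  with powr_le(1) show ?thesis
    by (intro that[of "1 / (144 * b)"]) auto
qed

lemma growth_times_decay_bigo:
  fixes C \<eta> :: real
  assumes \<eta>: "0 < \<eta>" "\<eta> < 2/3"
  obtains c where "c > 0"
    "(\<lambda>n. exp (C / (1 - exp (- d n)) powr \<eta>)
        * (exp (- circle_decay (d n) (arc_width n)) * (2 * pi / (d n)\<^sup>2)))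
      \<in> O(\<lambda>n. exp (- c * tail_rate n))"
proof -
  define g where "g = (\<lambda>n. C / (1 - exp (- d n)) powr \<eta>)"
  obtain c where decay_ge: "c > 0"
    "\<forall>\<^sub>F n in sequentially. c * tail_rate n \<le> circle_decay (d n) (arc_width n)"
    by (rule circle_decay_ge_tail_rate)
  have growth: "\<forall>\<^sub>F n in sequentially. norm (g n + ln (real n)) \<le> c / 2 * norm (tail_rate n)"
    using landau_o.smallD[OF growth_smallo_tail_rate[OF \<eta>, of C], of "c / 2"] decay_ge(1)
    unfolding g_def by simp
  obtain b where powr_le: "b > 0"
    "\<forall>\<^sub>F n in sequentially. norm (d n powr (-2)) \<le> b * norm (real n)"
    using landau_o.bigE[OF powr_minus_2_bigo] .
  have "\<forall>\<^sub>F n in sequentially.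
    norm (exp (g n) * (exp (- circle_decay (d n) (arc_width n)) * (2 * pi / (d n)\<^sup>2)))
      \<le> 2 * pi * b * norm (exp (- (c / 2) * tail_rate n))"
    using growth powr_le(2) decay_ge(2) eventually_d eventually_gt_at_top[of 0]
  proof eventually_elim
    case (elim n)
    have "2 * pi / (d n)\<^sup>2 \<le> 2 * pi * (b * exp (ln (real n)))"
      using elim by (simp add: powr_minus field_simps)
    then have "exp (g n) * (exp (- circle_decay (d n) (arc_width n)) * (2 * pi / (d n)\<^sup>2))
        \<le> exp (g n) * (exp (- c * tail_rate n) * (2 * pi * (b * exp (ln (real n)))))"
      using elim powr_le(1) by (intro mult_left_mono mult_mono) auto
    also have "\<dots> = 2 * pi * b * exp (g n + ln (real n) - c * tail_rate n)"
      by (simp add: exp_add exp_diff exp_minus field_simps)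
    also have "\<dots> \<le> 2 * pi * b * exp (- (c / 2) * tail_rate n)"
      using elim(1) abs_ge_self[of "g n + ln (real n)"] powr_le(1) tail_rate_nonneg[of n]
      by (intro mult_left_mono) (simp_all add: field_simps)
    finally show ?case by simp
  qed
  with decay_ge(1) show ?thesis
    by (intro that[of "c / 2"] bigoI) (simp_all add: g_def)
qed

lemma far_arc_integral_bigo:
  fixes F :: "complex \<Rightarrow> complex" and C \<eta> :: real
  assumes \<eta>: "0 < \<eta>" "\<eta> < 2/3"
    and F: "F \<in> O[filtercomap norm (at_left 1)](\<lambda>x. of_real (exp (C / (1 - norm x) powr \<eta>)))"
  obtains c where "c > 0" "(\<lambda>n. arc_integral (- near_arc n) (\<lambda>x. F x - F (z n)) (d n) n)
      \<in> O(\<lambda>n. of_real (exp (- c * tail_rate n)))"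
proof -
  define w where "w = (\<lambda>n. exp (C / (1 - exp (- d n)) powr \<eta>)
      * (exp (- circle_decay (d n) (arc_width n)) * (2 * pi / (d n)\<^sup>2)))"
  obtain c where weight_bigo: "c > 0" "w \<in> O(\<lambda>n. exp (- c * tail_rate n))"
    unfolding w_def by (rule growth_times_decay_bigo[OF \<eta>])
  obtain K where F_le: "K > 0" "\<forall>\<^sub>F n in sequentially. \<forall>\<theta>.
      norm (F (rcis (exp (- d n)) \<theta>)) \<le> K * exp (C / (1 - exp (- d n)) powr \<eta>)"
    using eventually_norm_le_on_circles[OF F] by auto
  have "\<forall>\<^sub>F n in sequentially.
      norm (arc_integral (- near_arc n) (\<lambda>x. F x - F (z n)) (d n) n) \<le> 2 * K * norm (w n)"
    using F_le(2) eventually_d eventually_gt_at_top[of 0]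
  proof eventually_elim
    case (elim n)
    have "norm (F (rcis (exp (- d n)) \<theta>) - F (z n)) \<le> 2 * K * exp (C / (1 - exp (- d n)) powr \<eta>)" for \<theta>
      using norm_triangle_ineq4[of "F (rcis (exp (- d n)) \<theta>)" "F (z n)"] elim(1)[rule_format, of \<theta>]
        elim(1)[rule_format, of 0] by simp
    moreover have "0 \<le> arc_width n"
      using elim by (simp add: arc_width_def)
    ultimately have "norm (arc_integral (- near_arc n) (\<lambda>x. F x - F (z n)) (d n) n)
        \<le> 2 * K * exp (C / (1 - exp (- d n)) powr \<eta>)
          * (exp (- circle_decay (d n) (arc_width n)) * (2 * pi / (d n)\<^sup>2))"
      using elim F_le(1) by (intro norm_arc_integral_le_decay) auto
    then show ?case by (simp add: w_def mult.assoc)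
  qed
  then have "(\<lambda>n. arc_integral (- near_arc n) (\<lambda>x. F x - F (z n)) (d n) n)
      \<in> O(\<lambda>n. of_real (w n))"
    by (intro bigoI) simp
  also have "(\<lambda>n. complex_of_real (w n)) \<in> O(\<lambda>n. of_real (exp (- c * tail_rate n)))"
    using weight_bigo(2) by (simp only: landau_o.big.of_real_iff)
  finally show ?thesis
    using weight_bigo(1) by (intro that)
qed

lemma far_error_bigo:
  fixes F :: "complex \<Rightarrow> complex" and C \<eta> :: real
  assumes "0 < \<eta>" "\<eta> < 2/3"
    and "F \<in> O[filtercomap norm (at_left 1)](\<lambda>x. of_real (exp (C / (1 - norm x) powr \<eta>)))"
  obtains c where "c > 0" "far_error F \<in> O(\<lambda>n. of_real (exp (- c * tail_rate n)))"
proof -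
  obtain c where arc_bigo: "c > 0" "(\<lambda>n. arc_integral (- near_arc n) (\<lambda>x. F x - F (z n)) (d n) n)
      \<in> O(\<lambda>n. of_real (exp (- c * tail_rate n)))"
    by (rule far_arc_integral_bigo[OF assms])
  have "(\<lambda>n. inverse (kernel_mass n)) \<in> O(\<lambda>_. 1)"
    by (rule bigoI_tendsto[where c = "inverse (of_real (sqrt (pi / (3 * zeta 3))))"])
       (use tendsto_inverse[OF kernel_mass_tendsto kernel_mass_limit_nonzero] in simp_all)
  from landau_o.big.mult[OF arc_bigo(2) this]
  have "far_error F \<in> O(\<lambda>n. of_real (exp (- c * tail_rate n)))"
    by (simp add: far_error_def[abs_def] divide_inverse)
  with arc_bigo(1) show ?thesis by (rule that)
qed

end

theorem theorem1:
  fixes d r \<delta> :: "nat \<Rightarrow> real" and \<beta> :: real and F :: "complex \<Rightarrow> complex"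
  assumes \<beta>: "\<beta> > 0"
    and d: "(\<lambda>n. d n - ((2 * zeta 3 / real n) powr (1/3) - 1 / (36 * real n)))
              \<in> O(\<lambda>n. real n powr (- 1 - \<beta>))"
    and r: "\<And>n. r n = exp (- d n)"
    and \<delta>: "\<And>n. \<delta> n = d n powr (5/3) / ln (real n)"
    and F: "F analytic_on ball 0 1"
    and A: "\<And>\<epsilon>. \<epsilon> > 0 \<Longrightarrow> \<forall>\<^sub>F n in sequentially. \<forall>\<theta>::real. \<bar>\<theta>\<bar> \<le> \<delta> n \<longrightarrow>
              norm (F (of_real (r n) * exp (\<i> * of_real \<theta>)) / F (of_real (r n)) - 1) < \<epsilon>"
    and B: "\<exists>C>0. \<exists>\<eta>\<in>{0<..<2/3}.
              F \<in> O[filtercomap norm (at_left 1)](\<lambda>x. of_real (exp (C / (1 - norm x) powr \<eta>)))"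
  shows "\<exists>c>0. \<exists>e1 e2 :: nat \<Rightarrow> complex.
           e1 \<in> o(\<lambda>n. 1) \<and>
           e2 \<in> O(\<lambda>n. of_real (exp (- c * real n powr (2/9) / (ln (real n))\<^sup>2))) \<and>
           (\<forall>\<^sub>F n in sequentially.
              1 / q n * ps_coeff n (\<lambda>x. Q x * F x)
                = F (of_real (exp (- d n))) * (1 + e1 n) + e2 n)"
proof -
  interpret saddle_sequence d
    by (rule saddle_sequenceI[OF leading_error_smallo[OF \<beta> d]])
  have flat: "\<forall>\<^sub>F n in sequentially. \<forall>\<theta>. \<bar>\<theta>\<bar> \<le> arc_width n \<longrightarrow>
      norm (F (rcis (exp (- d n)) \<theta>) / F (z n) - 1) < \<epsilon>" if "\<epsilon> > 0" for \<epsilon>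
    using A[OF that] by (simp add: r \<delta> arc_width_def rcis_def cis_conv_exp)
  have near: "(\<lambda>n. near_error F n / F (z n)) \<in> o(\<lambda>n. 1)"
    by (rule near_error_smallo[OF flat])
  obtain C \<eta> where "0 < \<eta>" "\<eta> < 2/3"
    and "F \<in> O[filtercomap norm (at_left 1)](\<lambda>x. of_real (exp (C / (1 - norm x) powr \<eta>)))"
    using B by auto
  then obtain c where c_pos: "c > 0" and far: "far_error F \<in> O(\<lambda>n. of_real (exp (- c * tail_rate n)))"
    by (rule far_error_bigo)
  have "\<forall>\<^sub>F n in sequentially. F (z n) \<noteq> 0"
    by (rule eventually_nonzero_of_flat[OF flat])
  with coefficient_ratio[OF analytic_imp_holomorphic[OF F]]
  have "\<forall>\<^sub>F n in sequentially. 1 / q n * ps_coeff n (\<lambda>x. Q x * F x)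
      = F (z n) * (1 + near_error F n / F (z n)) + far_error F n"
    by eventually_elim (simp add: distrib_left)
  with c_pos near far show ?thesis
    unfolding tail_rate_def by (intro exI[of _ c] exI conjI) (auto simp: times_divide_eq_right)
qed

end
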